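(* Let $v=(1,0,0)\in\mathbb R^{2,1}$, let $D=I^+(0)\subset\mathbb R^{2,1}$, and for $k\ge 3$ let $D_k$ be the intersection of the futures of the $k$ lightlike planes which pass through $0$ and contain the edges of the polygon $C_k$, where $C_k$ is a regular polygon with $k$ edges, contained in the plane $\{x_0=1\}$, all of whose edges are tangent to the circle $C=\partial I^+(0)\cap\{x_0=1\}$ of radius $1$. Let $\iota_v$ and $\iota_v^k$ be the frequency functions on $P_v$ of $D$ and $D_k$ respectively. Then the sequence $\iota_v^k$ converges weakly to $\tfrac12\iota_v$ in $L^1_{loc}(P_v)$ as $k\to\infty$, i.e. for every continuous compactly supported function $\phi$ on $P_v$, $$\int_{P_v}\phi\,\iota_v^k\,dV\longrightarrow\frac12\int_{P_v}\phi\,\iota_v\,dV .$$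
   Context: $\mathbb R^{2,1}$ is $\mathbb R^3$ with coordinates $(x_0,x_1,x_2)$ and Minkowski metric $-dx_0^2+dx_1^2+dx_2^2$; $I^+(0)$ is the set of future-directed timelike vectors. $P_v=\{x_0=0\}$ is the plane orthogonal to $v$, with area measure $dV$. Frequency function of a domain of dependence $D$ (an open convex domain which is an intersection of futures of lightlike planes, with at least two non-parallel lightlike planes in its complement): the cosmological time $\tau:D\to(0,\infty)$ is the supremum of Lorentzian lengths of causal curves in $D$ ending at the given point; $H_\epsilon=\tau^{-1}(\epsilon)$ is a spacelike surface which is the graph $\{x+u_\epsilon(x)v:x\in P_v\}$ of a convex function; $\nu_\epsilon$ is its future-directed unit normal; $\iota_\epsilon(x)=-\epsilon\langle\nu_\epsilon(x+u_\epsilon(x)v),v\rangle$; the frequency function is $\iota_v(x)=\lim_{\epsilon\to0}\iota_\epsilon(x)$ (the limit exists and is finite for all $x\in P_v$). *)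

theory Defs
  imports "HOL-Analysis.Analysis"
begin

text \<open>
  The first component is the time coordinate \<open>x\<^sub>0\<close>, the second is \<open>(x\<^sub>1, x\<^sub>2)\<close>.
  The plane \<open>P\<^sub>v = {x\<^sub>0 = 0}\<close> is parametrised by \<open>y \<mapsto> (0, y)\<close>; this is an isometry for the
  Euclidean metric of \<open>real^2\<close>, so the area measure of \<open>P\<^sub>v\<close> is \<open>lborel\<close> on \<open>real^2\<close>.
\<close>

type_synonym mink = "real \<times> (real^2)"

definition mform :: "mink \<Rightarrow> mink \<Rightarrow> real" where
  "mform x y = - fst x * fst y + snd x \<bullet> snd y"

definition vvec :: mink where
  "vvec = (1, 0)"

definition future_timelike :: "mink \<Rightarrow> bool" where
  "future_timelike x \<longleftrightarrow> mform x x < 0 \<and> fst x > 0"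

definition future_causal :: "mink \<Rightarrow> bool" where
  "future_causal x \<longleftrightarrow> mform x x \<le> 0 \<and> fst x > 0"

definition Iplus :: "mink set \<Rightarrow> mink set" where
  "Iplus A = {x. \<exists>a\<in>A. future_timelike (x - a)}"

definition lightlike_plane :: "mink set \<Rightarrow> bool" where
  "lightlike_plane P \<longleftrightarrow>
     (\<exists>a n. n \<noteq> 0 \<and> mform n n = 0 \<and> P = {x. mform (x - a) n = 0})"

text \<open>
  Future-directed causal curves are piecewise \<open>C\<^sup>1\<close> and parametrised by \<open>[0,1]\<close>. The
  velocity condition is void at the finitely many corners.
\<close>

definition causal_curve_in :: "mink set \<Rightarrow> (real \<Rightarrow> mink) \<Rightarrow> bool" where
  "causal_curve_in D \<gamma> \<longleftrightarrow>
     valid_path \<gamma> \<and> path_image \<gamma> \<subseteq> D \<and>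
     (\<forall>t\<in>{0<..<1}. \<gamma> differentiable (at t) \<longrightarrow>
        future_causal (vector_derivative \<gamma> (at t)))"

definition lorentz_length :: "(real \<Rightarrow> mink) \<Rightarrow> real" where
  "lorentz_length \<gamma> =
     integral {0..1} (\<lambda>t. sqrt (- mform (vector_derivative \<gamma> (at t)) (vector_derivative \<gamma> (at t))))"

text \<open>
  \<open>Sup\<close>, \<open>THE\<close> and \<open>Lim\<close> below carry their intended meaning when \<open>D\<close> is a domain of
  dependence: the cosmological time is then finite, its level surfaces are spacelike
  \<open>C\<^sup>1\<close> graphs over \<open>P\<^sub>v\<close>, and the limit defining the frequency function exists.
\<close>

definition cosmological_time :: "mink set \<Rightarrow> mink \<Rightarrow> real" where
  "cosmological_time D p =
     Sup {lorentz_length \<gamma> |\<gamma>. causal_curve_in D \<gamma> \<and> pathfinish \<gamma> = p}"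

definition level_surface :: "mink set \<Rightarrow> real \<Rightarrow> mink set" where
  "level_surface D \<epsilon> = {p \<in> D. cosmological_time D p = \<epsilon>}"

text \<open>The function \<open>u\<^sub>\<epsilon>\<close> whose graph over \<open>P\<^sub>v\<close> is the level surface.\<close>

definition graph_fun :: "mink set \<Rightarrow> real \<Rightarrow> real^2 \<Rightarrow> real" where
  "graph_fun D \<epsilon> y = (THE t. (0, y) + t *\<^sub>R vvec \<in> level_surface D \<epsilon>)"

text \<open>
  The tangent plane of the graph of \<open>u\<close> over \<open>y\<close> consists of the vectors \<open>(0, h) + u' h v\<close>.
\<close>

definition is_future_unit_normal :: "(real^2 \<Rightarrow> real) \<Rightarrow> real^2 \<Rightarrow> mink \<Rightarrow> bool" where
  "is_future_unit_normal u y n \<longleftrightarrow>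
     mform n n = -1 \<and> fst n > 0 \<and>
     (\<exists>u'. (u has_derivative u') (at y) \<and> (\<forall>h. mform n ((0, h) + u' h *\<^sub>R vvec) = 0))"

definition unit_normal :: "(real^2 \<Rightarrow> real) \<Rightarrow> real^2 \<Rightarrow> mink" where
  "unit_normal u y = (THE n. is_future_unit_normal u y n)"

definition freq_eps :: "mink set \<Rightarrow> real \<Rightarrow> real^2 \<Rightarrow> real" where
  "freq_eps D \<epsilon> y = - \<epsilon> * mform (unit_normal (graph_fun D \<epsilon>) y) vvec"

definition frequency :: "mink set \<Rightarrow> real^2 \<Rightarrow> real" where
  "frequency D y = Lim (at_right 0) (\<lambda>\<epsilon>. freq_eps D \<epsilon> y)"

text \<open>
  A polygon is represented by the set of its edges. A regular \<open>k\<close>-gon in the plane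
  \<open>{x\<^sub>0 = 1}\<close> has centre \<open>c\<close>, circumradius \<open>r\<close> and an arbitrary rotation angle \<open>\<alpha>\<close>.
\<close>

definition regular_vertex :: "nat \<Rightarrow> real^2 \<Rightarrow> real \<Rightarrow> real \<Rightarrow> nat \<Rightarrow> mink" where
  "regular_vertex k c r \<alpha> j =
     (1, c + r *\<^sub>R vector [cos (\<alpha> + 2 * pi * real j / real k), sin (\<alpha> + 2 * pi * real j / real k)])"

definition regular_polygon :: "nat \<Rightarrow> mink set set \<Rightarrow> bool" where
  "regular_polygon k C \<longleftrightarrow>
     (\<exists>c r \<alpha>. r > 0 \<and>
        C = {closed_segment (regular_vertex k c r \<alpha> j) (regular_vertex k c r \<alpha> (Suc j)) |j. j < k})"

definition light_circle :: "mink set" where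
  "light_circle = frontier (Iplus {0}) \<inter> {x. fst x = 1}"

text \<open>
  Tangency of a segment: its line is tangent to the circle, and the point of
  contact lies on the segment itself.
\<close>

definition segment_tangent :: "mink set \<Rightarrow> mink set \<Rightarrow> bool" where
  "segment_tangent E S \<longleftrightarrow> (\<exists>p\<in>E. affine hull E \<inter> S = {p})"

definition polygon_domain :: "mink set set \<Rightarrow> mink set" where
  "polygon_domain C =
     \<Inter> {Iplus P |P. lightlike_plane P \<and> 0 \<in> P \<and> (\<exists>E\<in>C. E \<subseteq> P)}"

definition locally_integrable :: "(real^2 \<Rightarrow> real) \<Rightarrow> bool" where
  "locally_integrable f \<longleftrightarrow> (\<forall>K. compact K \<longrightarrow> set_integrable lborel K f)"

end

theory Submission
  imports Defs
begin

text \<open>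
  If \<open>D\<close> lies in the future half-space of a spacelike plane through \<open>r\<close> with unit normal \<open>N\<close> and
  contains the segment \<open>r + \<sigma> N\<close>, \<open>0 < \<sigma> \<le> \<tau>\<close>, then \<open>r + \<tau> N\<close> has cosmological time \<open>\<tau>\<close>: for
  causal \<open>X\<close> the proper time of \<open>X\<close> is at most \<open>-\<langle>N, X\<rangle>\<close>. This gives \<open>u\<^sub>\<epsilon>\<close> explicitly. Tangency
  forces \<open>D\<^sub>k = {(t, y). y \<bullet> e\<^sub>n < t for all n}\<close> with contact points \<open>e\<^sub>n\<close> equally spaced on the
  unit circle, and for \<open>y = x e\<^sub>n + x' e\<^sub>n\<^sub>+\<^sub>1\<close> with \<open>x, x' \<ge> 0\<close> the frequency function of \<open>D\<^sub>k\<close> is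
  \<open>\<bar>x - x'\<bar>\<close>, whereas that of \<open>D\<close> is \<open>\<bar>y\<bar>\<close>.

  If \<open>R\<close> is the rotation by \<open>\<pi>/k\<close>, half the angle between neighbouring contact points, then
  \<open>\<bar>y\<bar> \<le> \<iota>\<^sup>k(y) + \<iota>\<^sup>k(R y) \<le> \<bar>y\<bar> / \<surd>(cos (\<pi>/k))\<close>. Since \<open>R\<close> preserves area,
  \<open>2 \<integral> \<phi> \<iota>\<^sup>k = \<integral> (\<phi> \<iota>\<^sup>k + (\<phi> \<circ> R) (\<iota>\<^sup>k \<circ> R))\<close>, and this integrand tends to \<open>\<phi>(y) \<bar>y\<bar>\<close>.
\<close>

section \<open>Cosmological time and its level surfaces\<close>

lemma mform_add_left: "mform (x + y) z = mform x z + mform y z"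
  and mform_add_right: "mform z (x + y) = mform z x + mform z y"
  and mform_diff_left: "mform (x - y) z = mform x z - mform y z"
  and mform_diff_right: "mform z (x - y) = mform z x - mform z y"
  and mform_scaleR_left: "mform (c *\<^sub>R x) z = c * mform x z"
  and mform_scaleR_right: "mform z (c *\<^sub>R x) = c * mform z x"
  by (simp_all add: mform_def algebra_simps inner_add_left inner_add_right inner_diff_left
      inner_diff_right)

lemma mform_commute: "mform x y = mform y x"
  by (simp add: mform_def inner_commute)

lemmas mform_simps = mform_add_left mform_add_right mform_diff_left mform_diff_right
  mform_scaleR_left mform_scaleR_right

lemma bounded_linear_mform: "bounded_linear (mform x)"
proof -
  have "mform x = (\<lambda>y. - fst x * fst y + snd x \<bullet> snd y)"
    by (simp add: mform_def fun_eq_iff)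
  then show ?thesis
    by (auto intro!: bounded_linear_intros)
qed

lemma mform_self: "mform x x = (norm (snd x))\<^sup>2 - (fst x)\<^sup>2"
  by (simp add: mform_def power2_eq_square dot_square_norm)

lemma future_causal_iff: "future_causal x \<longleftrightarrow> norm (snd x) \<le> fst x \<and> fst x > 0"
  unfolding future_causal_def mform_self by (auto intro: power2_le_imp_le)

lemma future_timelike_iff: "future_timelike x \<longleftrightarrow> norm (snd x) < fst x"
proof -
  have "norm (snd x) < fst x" if "(norm (snd x))\<^sup>2 < (fst x)\<^sup>2" "fst x > 0"
    using that by (auto intro: power2_less_imp_less)
  moreover have "(norm (snd x))\<^sup>2 < (fst x)\<^sup>2 \<and> fst x > 0" if "norm (snd x) < fst x"
    using that order.strict_trans1[OF norm_ge_zero that] by (auto intro!: power_strict_mono)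
  ultimately show ?thesis
    unfolding future_timelike_def mform_self by auto
qed

text \<open>The ordinary Cauchy-Schwarz inequality for the spatial parts reduces this to the four
  numbers \<open>a\<close>, \<open>b\<close>, \<open>t\<close>, \<open>y\<close>. For these the
  identity \<open>(a t - b y)^2 = (t^2 - y^2) (a^2 - b^2) + (a y - b t)^2\<close> with
  \<open>a^2 - b^2 = 1\<close> suffices.\<close>

lemma reversed_Cauchy_Schwarz:
  assumes "mform N N = -1" "fst N > 0" "future_causal X"
  shows "sqrt (- mform X X) \<le> - mform N X"
proof -
  define a b t y where "a = fst N" "b = norm (snd N)" "t = fst X" "y = norm (snd X)"
  note d = this
  have a: "a\<^sup>2 = 1 + b\<^sup>2" "a > 0" and t: "y \<le> t" "t > 0" and nn: "0 \<le> b" "0 \<le> y"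
    using assms by (auto simp: d mform_self future_causal_iff)
  have "b \<le> a"
    using a by (auto intro: power2_le_imp_le)
  then have ab: "b * y \<le> a * t"
    using t nn by (intro mult_mono) auto
  have "(a * t - b * y)\<^sup>2 = (t\<^sup>2 - y\<^sup>2) * (a\<^sup>2 - b\<^sup>2) + (a * y - b * t)\<^sup>2"
    by (simp add: power2_eq_square algebra_simps)
  then have "t\<^sup>2 - y\<^sup>2 \<le> (a * t - b * y)\<^sup>2"
    using a by simp
  then have "sqrt (t\<^sup>2 - y\<^sup>2) \<le> a * t - b * y"
    using ab by (intro real_le_lsqrt) auto
  moreover have "snd N \<bullet> snd X \<le> b * y"
    unfolding d by (rule norm_cauchy_schwarz)
  ultimately have "sqrt (t\<^sup>2 - y\<^sup>2) \<le> a * t - snd N \<bullet> snd X"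
    by linarith
  then show ?thesis
    by (simp add: mform_self) (simp add: mform_def d)
qed

lemma fst_unit_timelike_ge_1:
  assumes "mform N N = -1" "fst N > 0"
  shows "fst N \<ge> 1"
proof -
  have "1 \<le> (fst N)\<^sup>2"
    using assms(1) zero_le_power2[of "norm (snd N)"] unfolding mform_self by linarith
  then show ?thesis
    using assms by (auto intro: power2_le_imp_le)
qed

section \<open>Lengths of causal curves and bounds for the cosmological time\<close>

text \<open>The right-hand side is the integral of the derivative of
  \<open>- mform N (\<gamma> t)\<close>, and \<open>reversed_Cauchy_Schwarz\<close> compares the
  integrands away from finitely many points.\<close>

lemma lorentz_length_le:
  assumes \<gamma>: "causal_curve_in D \<gamma>" and N: "mform N N = -1" "fst N > 0"
  shows "lorentz_length \<gamma> \<le> - mform N (pathfinish \<gamma> - pathstart \<gamma>)"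
proof -
  let ?f = "\<lambda>t. sqrt (- mform (vector_derivative \<gamma> (at t)) (vector_derivative \<gamma> (at t)))"
  let ?g = "\<lambda>t. - mform N (vector_derivative \<gamma> (at t))"
  from \<gamma> obtain S where S: "finite S" "\<gamma> C1_differentiable_on {0..1} - S" "continuous_on {0..1} \<gamma>"
    unfolding causal_curve_in_def valid_path_def piecewise_C1_differentiable_on_def by blast
  \<comment> \<open>The end points join the corners because \<open>causal_curve_in\<close> restricts
    the velocity only on the open interval.\<close>
  define S' where "S' = S \<union> {0, 1}"
  have "finite S'"
    using S by (simp add: S'_def)
  have diff: "\<gamma> differentiable at t" if "t \<in> {0<..<1} - S'" for t
    using S(2) that by (auto simp: C1_differentiable_on_eq S'_def)
  have int: "(?g has_integral - mform N (\<gamma> 1) - - mform N (\<gamma> 0)) {0..1}"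
  proof (rule fundamental_theorem_of_calculus_interior_strong[OF \<open>finite S'\<close>])
    show "continuous_on {0..1} (\<lambda>t. - mform N (\<gamma> t))"
      by (intro continuous_intros bounded_linear.continuous_on[OF bounded_linear_mform] S)
    show "((\<lambda>t. - mform N (\<gamma> t)) has_vector_derivative ?g t) (at t)"
      if "t \<in> {0<..<1} - S'" for t
      using diff[OF that]
      by (intro has_vector_derivative_minus
          bounded_linear.has_vector_derivative[OF bounded_linear_mform])
        (simp add: vector_derivative_works[symmetric])
  qed simp
  have le: "?f t \<le> ?g t \<and> 0 \<le> ?g t" if "t \<in> {0..1} - S'" for t
  proof -
    have t: "t \<in> {0<..<1} - S'"
      using that by (auto simp: S'_def less_le)
    then have fc: "future_causal (vector_derivative \<gamma> (at t))"
      using \<gamma> diff unfolding causal_curve_in_def by blast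
    then have "0 \<le> ?f t"
      by (simp add: future_causal_def)
    with reversed_Cauchy_Schwarz[OF N fc] show ?thesis
      by linarith
  qed
  have "integral {0..1} ?f \<le> - mform N (\<gamma> 1) - - mform N (\<gamma> 0)"
  proof (cases "?f integrable_on {0..1}")
    case True
    let ?h = "\<lambda>t. if t \<in> S' then 0 else ?f t" and ?k = "\<lambda>t. if t \<in> S' then 0 else ?g t"
    have "(?h has_integral integral {0..1} ?f) {0..1}"
      by (rule has_integral_spike_finite[OF \<open>finite S'\<close> _ integrable_integral[OF True]]) auto
    moreover have "(?k has_integral - mform N (\<gamma> 1) - - mform N (\<gamma> 0)) {0..1}"
      by (rule has_integral_spike_finite[OF \<open>finite S'\<close> _ int]) auto
    ultimately show ?thesis
      by (rule has_integral_le) (use le in auto)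
  next
    \<comment> \<open>A non-integrable speed would make the length the default value 0, so only
      nonnegativity of the bound has to be shown.\<close>
    case False
    let ?k = "\<lambda>t. if t \<in> S' then 0 else ?g t"
    have "(?k has_integral - mform N (\<gamma> 1) - - mform N (\<gamma> 0)) {0..1}"
      by (rule has_integral_spike_finite[OF \<open>finite S'\<close> _ int]) auto
    then have "0 \<le> - mform N (\<gamma> 1) - - mform N (\<gamma> 0)"
      by (rule has_integral_nonneg) (use le in auto)
    with False show ?thesis
      by (simp add: not_integrable_integral)
  qed
  then show ?thesis
    by (simp add: lorentz_length_def pathfinish_def pathstart_def mform_simps)
qed

lemma straight_causal_curve:
  assumes "convex D" "p \<in> D" "q \<in> D" "future_causal (p - q)"
  shows "\<exists>\<gamma>. causal_curve_in D \<gamma> \<and> pathfinish \<gamma> = p \<and>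
    lorentz_length \<gamma> = sqrt (- mform (p - q) (p - q))"
proof (intro exI conjI)
  have d: "vector_derivative (linepath q p) (at t) = p - q" for t
    by (rule vector_derivative_linepath_at)
  show "causal_curve_in D (linepath q p)"
    using assms by (auto simp: causal_curve_in_def d closed_segment_subset)
  show "lorentz_length (linepath q p) = sqrt (- mform (p - q) (p - q))"
    by (simp add: lorentz_length_def d)
qed simp

text \<open>The straight segment from \<open>q\<close> to \<open>p\<close> is a competitor. The
  condition \<open>fst q \<ge> 0\<close> bounds all competitors by \<open>fst p\<close>, through
  \<open>lorentz_length_le\<close> with \<open>N = vvec\<close>, so that \<open>Sup\<close> is taken
  over a bounded set.\<close>

lemma cosmological_time_ge:
  assumes "convex D" "\<And>q. q \<in> D \<Longrightarrow> fst q \<ge> 0" "p \<in> D" "q \<in> D" "future_causal (p - q)"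
  shows "sqrt (- mform (p - q) (p - q)) \<le> cosmological_time D p"
proof -
  obtain \<gamma> where \<gamma>: "causal_curve_in D \<gamma>" "pathfinish \<gamma> = p"
    "lorentz_length \<gamma> = sqrt (- mform (p - q) (p - q))"
    using straight_causal_curve assms by blast
  have "lorentz_length \<gamma>' \<le> fst p" if "causal_curve_in D \<gamma>'" "pathfinish \<gamma>' = p" for \<gamma>'
  proof -
    have "fst (pathstart \<gamma>') \<ge> 0"
      using that(1) assms(2) pathstart_in_path_image unfolding causal_curve_in_def by blast
    then show ?thesis
      using lorentz_length_le[OF that(1), of vvec] that(2)
      by (simp add: vvec_def mform_def)
  qed
  then have "bdd_above {lorentz_length \<gamma> |\<gamma>. causal_curve_in D \<gamma> \<and> pathfinish \<gamma> = p}"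
    by (auto simp: bdd_above_def)
  then show ?thesis
    unfolding cosmological_time_def by (intro cSup_upper) (use \<gamma> in \<open>auto intro!: exI[of _ \<gamma>]\<close>)
qed

lemma exists_below_in_open:
  fixes D :: "(real \<times> 'a::metric_space) set"
  assumes "open D" "(t, y) \<in> D"
  shows "\<exists>s>0. (t - s, y) \<in> D"
proof -
  obtain e where e: "e > 0" "ball (t, y) e \<subseteq> D"
    using assms open_contains_ball by blast
  have "(t - e / 2, y) \<in> ball (t, y) e"
    using e by (simp add: dist_Pair_Pair dist_real_def)
  then show ?thesis
    using e by (intro exI[of _ "e / 2"]) auto
qed

text \<open>Every competitor starts on the future side of the plane through \<open>r\<close>
  orthogonal to \<open>N\<close>, so its length is at most the height of \<open>p\<close> over that
  plane. Openness supplies a short vertical segment, hence a nonempty set of lengths.\<close>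

lemma cosmological_time_le:
  assumes "convex D" "open D" "p \<in> D" and N: "mform N N = -1" "fst N > 0"
    and supp: "\<And>q. q \<in> D \<Longrightarrow> mform N (q - r) \<le> 0"
  shows "cosmological_time D p \<le> - mform N (p - r)"
  unfolding cosmological_time_def
proof (rule cSup_least)
  obtain s where s: "s > 0" "(fst p - s, snd p) \<in> D"
    using exists_below_in_open[of D "fst p" "snd p"] assms by auto
  have "future_causal (p - (fst p - s, snd p))"
    using s by (simp add: future_causal_iff)
  then show "{lorentz_length \<gamma> |\<gamma>. causal_curve_in D \<gamma> \<and> pathfinish \<gamma> = p} \<noteq> {}"
    using straight_causal_curve assms s by blast
next
  fix x assume "x \<in> {lorentz_length \<gamma> |\<gamma>. causal_curve_in D \<gamma> \<and> pathfinish \<gamma> = p}"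
  then obtain \<gamma> where \<gamma>: "x = lorentz_length \<gamma>" "causal_curve_in D \<gamma>" "pathfinish \<gamma> = p"
    by auto
  have "mform N (pathstart \<gamma> - r) \<le> 0"
    using \<gamma>(2) supp pathstart_in_path_image unfolding causal_curve_in_def by blast
  then show "x \<le> - mform N (p - r)"
    using lorentz_length_le[OF \<gamma>(2) N] \<gamma> by (simp add: mform_simps)
qed

text \<open>On the vertical line over \<open>y\<close> the supporting plane bounds the cosmological
  time from above and the ray from \<open>r\<close> bounds it from below. Both bounds equal
  \<open>\<tau>\<close> at height \<open>t\<close>; the time is larger than \<open>\<tau>\<close>
  above \<open>t\<close> and smaller below, which gives the uniqueness that \<open>THE\<close>
  requires.\<close>

lemma graph_fun_eqI:
  assumes "convex D" "open D" and pos: "\<And>q. q \<in> D \<Longrightarrow> fst q \<ge> 0"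
    and N: "mform N N = -1" "fst N > 0"
    and supp: "\<And>q. q \<in> D \<Longrightarrow> mform N (q - r) \<le> 0"
    and "\<tau> > 0" and ray: "\<And>\<sigma>. 0 < \<sigma> \<Longrightarrow> \<sigma> \<le> \<tau> \<Longrightarrow> r + \<sigma> *\<^sub>R N \<in> D"
    and p: "r + \<tau> *\<^sub>R N = (t, y)"
  shows "graph_fun D \<tau> y = t"
proof -
  note N1 = fst_unit_timelike_ge_1[OF N]
  have p': "(t', y) = r + \<tau> *\<^sub>R N + (t' - t) *\<^sub>R vvec" for t'
    unfolding p by (simp add: vvec_def)
  have upper: "cosmological_time D (t', y) \<le> \<tau> + (t' - t) * fst N" if "(t', y) \<in> D" for t'
  proof -
    have "- mform N ((t', y) - r) = \<tau> + (t' - t) * fst N"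
      unfolding p'[of t'] using N(1) by (simp add: mform_simps) (simp add: mform_def vvec_def)
    then show ?thesis
      using cosmological_time_le[OF assms(1,2) that N supp] by simp
  qed
  \<comment> \<open>The foot point \<open>r\<close> is not assumed to lie in \<open>D\<close>, so
    the segment starts at \<open>r + \<sigma> *\<^sub>R N\<close>, which costs at most
    \<open>e\<close>.\<close>
  have lower: "\<tau> + (t' - t) \<le> cosmological_time D (t', y)" if "(t', y) \<in> D" "t' \<ge> t" for t'
  proof (rule field_le_epsilon)
    fix e :: real assume "e > 0"
    define \<sigma> where "\<sigma> = min (\<tau> / 2) e"
    have \<sigma>: "0 < \<sigma>" "\<sigma> < \<tau>" "\<sigma> \<le> e"
      using \<open>\<tau> > 0\<close> \<open>e > 0\<close> by (auto simp: \<sigma>_def)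
    let ?q = "r + \<sigma> *\<^sub>R N"
    have diff: "(t', y) - ?q = (\<tau> - \<sigma>) *\<^sub>R N + (t' - t) *\<^sub>R vvec"
      unfolding p'[of t'] by (simp add: algebra_simps)
    \<comment> \<open>A reversed triangle inequality with explicit excess: the last summand is
      nonnegative because \<open>fst N \<ge> 1\<close>.\<close>
    have mf: "- mform ((t', y) - ?q) ((t', y) - ?q)
        = (\<tau> - \<sigma> + (t' - t))\<^sup>2 + 2 * ((\<tau> - \<sigma>) * (t' - t)) * (fst N - 1)"
      unfolding diff using N(1) mform_commute[of vvec N]
      by (simp add: mform_simps)
        (simp add: mform_def vvec_def power2_eq_square algebra_simps)
    have ge: "(\<tau> - \<sigma> + (t' - t))\<^sup>2 \<le> - mform ((t', y) - ?q) ((t', y) - ?q)"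
      unfolding mf using \<sigma> that N1 by simp
    have "fst ((t', y) - ?q) > 0"
      unfolding diff using \<sigma> that N by (simp add: vvec_def add_pos_nonneg)
    then have "future_causal ((t', y) - ?q)"
      unfolding future_causal_def using ge by (smt (verit) zero_le_power2)
    then have "sqrt (- mform ((t', y) - ?q) ((t', y) - ?q)) \<le> cosmological_time D (t', y)"
      using cosmological_time_ge[OF assms(1) pos that(1)] ray \<sigma> by simp
    moreover have "\<tau> - \<sigma> + (t' - t) \<le> sqrt (- mform ((t', y) - ?q) ((t', y) - ?q))"
      using ge by (rule real_le_rsqrt)
    ultimately show "\<tau> + (t' - t) \<le> cosmological_time D (t', y) + e"
      using \<sigma> by linarith
  qed
  have tD: "(t, y) \<in> D"
    using ray[of \<tau>] \<open>\<tau> > 0\<close> p by simp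
  show ?thesis
    unfolding graph_fun_def
  proof (rule the_equality)
    show "(0, y) + t *\<^sub>R vvec \<in> level_surface D \<tau>"
      using tD upper[OF tD] lower[OF tD] by (simp add: level_surface_def vvec_def)
    fix t' assume "(0, y) + t' *\<^sub>R vvec \<in> level_surface D \<tau>"
    then have t': "(t', y) \<in> D" "cosmological_time D (t', y) = \<tau>"
      by (auto simp: level_surface_def vvec_def)
    show "t' = t"
    proof (rule ccontr)
      assume "t' \<noteq> t"
      then consider "t' > t" | "t' < t"
        by linarith
      then show False
      proof cases
        case 1
        then show ?thesis using lower[of t'] t' by simp
      next
        case 2
        then have "(t' - t) * fst N < 0"
          using N by (simp add: mult_neg_pos)
        then show ?thesis using upper[of t'] t' by simp
      qed
    qed
  qed
qed

section \<open>Normals and frequency from the gradient of the graph\<close>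

text \<open>Orthogonality to all tangent vectors forces a multiple of \<open>(1, g)\<close>; the
  normalisation and the time orientation fix the factor. The condition on \<open>g\<close> says that
  the tangent plane is spacelike.\<close>

lemma unit_normal_eq:
  assumes u: "(u has_derivative (\<lambda>h. g \<bullet> h)) (at y)" and g: "g \<bullet> g < 1"
  shows "unit_normal u y = (1 / sqrt (1 - g \<bullet> g), (1 / sqrt (1 - g \<bullet> g)) *\<^sub>R g)"
  unfolding unit_normal_def
proof (rule the_equality)
  define a where "a = 1 / sqrt (1 - g \<bullet> g)"
  have a: "a > 0" "a\<^sup>2 * (1 - g \<bullet> g) = 1"
    using g by (auto simp: a_def power_divide)
  show "is_future_unit_normal u y (1 / sqrt (1 - g \<bullet> g), (1 / sqrt (1 - g \<bullet> g)) *\<^sub>R g)"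
    unfolding is_future_unit_normal_def a_def[symmetric] using a u
    by (auto simp: mform_def vvec_def algebra_simps power2_eq_square intro!: exI[of _ "\<lambda>h. g \<bullet> h"])
  fix n assume "is_future_unit_normal u y n"
  then obtain u' where n: "mform n n = -1" "fst n > 0" and u': "(u has_derivative u') (at y)"
    and orth: "\<And>h. mform n ((0, h) + u' h *\<^sub>R vvec) = 0"
    by (auto simp: is_future_unit_normal_def)
  have "u' = (\<lambda>h. g \<bullet> h)"
    using has_derivative_unique u u' by blast
  then have "(snd n - fst n *\<^sub>R g) \<bullet> h = 0" for h
    using orth[of h] by (simp add: mform_def vvec_def inner_diff_left)
  then have eq: "snd n = fst n *\<^sub>R g"
    using vector_eq_ldot[of "snd n - fst n *\<^sub>R g" 0] by (metis eq_iff_diff_eq_0 inner_eq_zero_iff)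
  then have "(fst n)\<^sup>2 * (1 - g \<bullet> g) = 1"
    using n(1) by (simp add: mform_def power2_eq_square algebra_simps)
  then have "(fst n)\<^sup>2 = a\<^sup>2"
    using a g by (metis mult_right_cancel mult_zero_right zero_neq_one)
  then have "fst n = a"
    using a n by (simp add: power2_eq_iff_nonneg)
  then show "n = (1 / sqrt (1 - g \<bullet> g), (1 / sqrt (1 - g \<bullet> g)) *\<^sub>R g)"
    using eq by (simp add: a_def[symmetric] prod_eq_iff)
qed

text \<open>The derivative is local, so a formula for the graph near \<open>y\<close> is enough,
  even if other formulas hold elsewhere. The pairing with \<open>vvec\<close> picks out the time
  component of the normal.\<close>

lemma freq_eps_eq:
  assumes "\<forall>\<^sub>F z in nhds y. graph_fun D \<epsilon> z = U z"
    and "(U has_derivative (\<lambda>h. g \<bullet> h)) (at y)" "g \<bullet> g < 1"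
  shows "freq_eps D \<epsilon> y = \<epsilon> / sqrt (1 - g \<bullet> g)"
proof -
  have ev: "\<forall>\<^sub>F z in at y. U z = graph_fun D \<epsilon> z"
    using assms(1) by (auto simp: eventually_at_filter elim: eventually_mono)
  have "(graph_fun D \<epsilon> has_derivative (\<lambda>h. g \<bullet> h)) (at y)"
    by (rule has_derivative_transform_eventually[OF assms(2) ev])
      (use eventually_nhds_x_imp_x[OF assms(1)] in auto)
  from unit_normal_eq[OF this assms(3)] show ?thesis
    by (simp add: freq_eps_def mform_def vvec_def)
qed

section \<open>Equally spaced unit vectors\<close>

definition dir :: "real \<Rightarrow> real^2" where
  "dir a = vector [cos a, sin a]"

lemma vec2_eq_iff: "x = y \<longleftrightarrow> x $ 1 = y $ 1 \<and> x $ 2 = y $ 2" for x y :: "real^2"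
  by (simp add: vec_eq_iff forall_2)

lemma dir_nth [simp]: "dir a $ 1 = cos a" "dir a $ 2 = sin a"
  by (simp_all add: dir_def)

lemma inner_dir_dir: "dir a \<bullet> dir b = cos (a - b)"
  by (simp add: inner_vec_def sum_2 cos_diff)

lemma norm_dir [simp]: "norm (dir a) = 1"
  by (simp add: norm_eq_sqrt_inner inner_dir_dir)

lemma dir_periodic: "dir (a + 2 * pi * of_int n) = dir a"
  using sin_int_2pin[of n] cos_int_2pin[of n]
  by (simp add: vec2_eq_iff sin_add cos_add mult.assoc)

text \<open>This gives the coordinates of a unit vector with respect to \<open>dir a\<close> and
  \<open>dir b\<close>; without division it holds for all angles.\<close>

lemma dir_combination: "sin (b - a) *\<^sub>R dir c = sin (b - c) *\<^sub>R dir a + sin (c - a) *\<^sub>R dir b"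
  by (simp add: vec2_eq_iff sin_diff algebra_simps)

lemma dir_add_dir: "dir a + dir b = (2 * cos ((b - a) / 2)) *\<^sub>R dir ((a + b) / 2)"
proof -
  have "cos ((b - a) / 2) = cos ((a - b) / 2)"
    by (metis cos_minus minus_diff_eq minus_divide_left)
  then show ?thesis
    by (simp add: vec2_eq_iff cos_plus_cos sin_plus_sin mult_ac)
qed

lemma polar_form: "\<exists>\<psi>. y = norm y *\<^sub>R dir \<psi>"
proof (cases "y = 0")
  case False
  have "(y $ 1 / norm y)\<^sup>2 + (y $ 2 / norm y)\<^sup>2 = 1"
    using False
    by (simp add: power_divide add_divide_distrib[symmetric] norm_eq_sqrt_inner inner_vec_def
        sum_2 power2_eq_square[symmetric] sum_power2_eq_zero_iff vec2_eq_iff)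
  from sincos_total_2pi[OF this] obtain \<psi>
    where \<psi>: "y $ 1 / norm y = cos \<psi>" "y $ 2 / norm y = sin \<psi>"
    by blast
  have "y $ 1 = norm y * (y $ 1 / norm y)" "y $ 2 = norm y * (y $ 2 / norm y)"
    using False by simp_all
  then have "y = norm y *\<^sub>R dir \<psi>"
    unfolding \<psi> by (subst vec2_eq_iff) simp
  then show ?thesis ..
qed simp

section \<open>Contact directions and the sectors between them\<close>

text \<open>The index runs over all integers, so that \<open>n + 1\<close> is the next contact
  direction without any wrap-around; \<open>fan_mod\<close> provides the period.\<close>

definition fan :: "nat \<Rightarrow> real \<Rightarrow> int \<Rightarrow> real^2" where
  "fan k \<phi> n = dir (\<phi> + 2 * pi * of_int n / real k)"

abbreviation fan_cos :: "nat \<Rightarrow> real" where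
  "fan_cos k \<equiv> cos (2 * pi / real k)"

text \<open>Each inequality describes the future of one lightlike plane through 0, as
  \<open>Iplus_lightlike_plane\<close> shows. By periodicity there are only \<open>k\<close>
  different ones.\<close>

definition fan_domain :: "nat \<Rightarrow> real \<Rightarrow> mink set" where
  "fan_domain k \<phi> = {p. \<forall>n. snd p \<bullet> fan k \<phi> n < fst p}"

lemma norm_fan [simp]: "norm (fan k \<phi> n) = 1"
  by (simp add: fan_def)

lemma inner_fan_self [simp]: "fan k \<phi> n \<bullet> fan k \<phi> n = 1"
  by (simp add: dot_square_norm)

lemma inner_fan_Suc [simp]: "fan k \<phi> n \<bullet> fan k \<phi> (n + 1) = fan_cos k"
  and inner_fan_Suc' [simp]: "fan k \<phi> (n + 1) \<bullet> fan k \<phi> n = fan_cos k"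
proof -
  show "fan k \<phi> (n + 1) \<bullet> fan k \<phi> n = fan_cos k"
    by (simp add: fan_def inner_dir_dir add_divide_distrib algebra_simps)
  then show "fan k \<phi> n \<bullet> fan k \<phi> (n + 1) = fan_cos k"
    by (simp add: inner_commute)
qed

lemma fan_mod:
  assumes "k > 0"
  shows "fan k \<phi> (n mod int k) = fan k \<phi> n"
proof -
  have "of_int n = (of_int (n mod int k) + real k * of_int (n div int k) :: real)"
    by (metis mod_mult_div_eq of_int_add of_int_mult of_int_of_nat_eq)
  then have "\<phi> + 2 * pi * of_int n / real k
      = \<phi> + 2 * pi * of_int (n mod int k) / real k + 2 * pi * of_int (n div int k)"
    using assms by (simp add: field_simps)
  then have "fan k \<phi> n
      = dir (\<phi> + 2 * pi * of_int (n mod int k) / real k + 2 * pi * of_int (n div int k))"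
    by (simp only: fan_def)
  also have "\<dots> = fan k \<phi> (n mod int k)"
    unfolding dir_periodic fan_def ..
  finally show ?thesis ..
qed

text \<open>Passes to finitely many indices, as needed for open intersections, eventualities and
  maxima. The predicate takes two neighbours so that it also covers sums
  \<open>e_n + e_(n+1)\<close>.\<close>

lemma all_fan_iff:
  assumes "k > 0"
  shows "(\<forall>n. P (fan k \<phi> n) (fan k \<phi> (n + 1))) \<longleftrightarrow>
    (\<forall>n\<in>{0..<int k}. P (fan k \<phi> n) (fan k \<phi> (n + 1)))"
proof safe
  fix n :: int
  assume *: "\<forall>n\<in>{0..<int k}. P (fan k \<phi> n) (fan k \<phi> (n + 1))"
  have "fan k \<phi> (n mod int k + 1) = fan k \<phi> (n + 1)"
    using fan_mod[OF assms, of \<phi> "n mod int k + 1"] fan_mod[OF assms, of \<phi> "n + 1"]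
    by (simp add: mod_add_left_eq)
  with *[rule_format, of "n mod int k"] show "P (fan k \<phi> n) (fan k \<phi> (n + 1))"
    using assms by (simp add: fan_mod)
qed auto

text \<open>Modulo \<open>2 k\<close> an odd number lies between 1 and \<open>2 k - 1\<close>, so
  the angle stays at distance at least \<open>pi / k\<close> from every multiple of
  \<open>2 pi\<close>.\<close>

lemma cos_odd_multiple_le:
  assumes "k > 0" "odd m"
  shows "cos (pi * of_int m / real k) \<le> cos (pi / real k)"
proof -
  define j where "j = m mod (2 * int k)"
  have "odd j"
    using assms by (simp add: j_def dvd_mod_iff)
  moreover have "0 \<le> j" "j < 2 * int k"
    using assms by (auto simp: j_def)
  ultimately have j: "1 \<le> j" "j \<le> 2 * int k - 1"
    by (auto simp: order_le_less)
  have "pi * of_int m / real k = pi * of_int j / real k + 2 * pi * of_int (m div (2 * int k))"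
  proof -
    have "m = j + 2 * int k * (m div (2 * int k))"
      unfolding j_def by (rule mod_mult_div_eq[symmetric])
    from arg_cong[OF this, of real_of_int] have "of_int m = (of_int j + 2 * real k * of_int (m div (2 * int k)) :: real)"
      by (simp only: of_int_add of_int_mult of_int_numeral of_int_of_nat_eq)
    then show ?thesis
      using assms(1) by (simp add: field_simps)
  qed
  then have eq: "cos (pi * of_int m / real k) = cos (pi * of_int j / real k)"
    using dir_periodic[of "pi * of_int j / real k" "m div (2 * int k)"] by (metis dir_nth(1))
  show ?thesis
  proof (cases "j \<le> int k")
    case True
    then have "(of_int j :: real) \<le> real k" "(1 :: real) \<le> of_int j"
      using j by linarith+
    then show ?thesis
      unfolding eq using assms(1)
      by (intro cos_monotone_0_pi_le) (auto simp: field_simps)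
  next
    case False
    then have "real k \<le> (of_int j :: real)" "(of_int j :: real) \<le> 2 * real k - 1"
      using j by linarith+
    then have "cos (2 * pi - pi * of_int j / real k) \<le> cos (pi / real k)"
      using assms(1) mult_left_mono[of "of_int j" "2 * real k - 1" pi]
      by (intro cos_monotone_0_pi_le) (auto simp: field_simps)
    then show ?thesis
      unfolding eq by simp
  qed
qed

lemma fan_cos_eq:
  assumes "k > 0"
  shows "fan_cos k = 2 * (cos (pi / real k))\<^sup>2 - 1"
  using cos_double_cos[of "pi / real k"] by simp

lemma cos_pi_div_pos:
  assumes "k \<ge> 3"
  shows "cos (pi / real k) > 0" "cos (pi / real k) < 1"
proof -
  have "pi / real k \<le> pi / 3"
    using assms by (intro divide_left_mono) auto
  then have *: "0 < pi / real k" "pi / real k < pi / 2"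
    using assms pi_gt_zero by (auto simp del: pi_gt_zero)
  then show "cos (pi / real k) > 0"
    by (intro cos_gt_zero)
  show "cos (pi / real k) < 1"
    using cos_monotone_0_pi[of 0 "pi / real k"] * by simp
qed

lemma fan_cos_bounds:
  assumes "k \<ge> 3"
  shows "-1 < fan_cos k" "fan_cos k < 1"
proof -
  note c = cos_pi_div_pos[OF assms]
  have "(cos (pi / real k))\<^sup>2 > 0" "(cos (pi / real k))\<^sup>2 < 1"
    using c by (auto simp: power_less_one_iff)
  then show "-1 < fan_cos k" "fan_cos k < 1"
    using fan_cos_eq[of k] assms by auto
qed

text \<open>The sum points along the bisector, which makes an odd multiple of \<open>pi / k\<close>
  with every contact direction. Thus \<open>(1 + fan_cos k, e_n + e_(n+1))\<close> satisfies all
  inequalities of \<open>fan_domain\<close> weakly, with equality for \<open>n\<close> and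
  \<open>n + 1\<close>: it spans the ridge between these two faces.\<close>

lemma fan_mid_inner_le:
  assumes "k \<ge> 3"
  shows "(fan k \<phi> n + fan k \<phi> (n + 1)) \<bullet> fan k \<phi> i \<le> 1 + fan_cos k"
proof -
  have "(fan k \<phi> n + fan k \<phi> (n + 1)) \<bullet> fan k \<phi> i
      = cos (2 * pi * of_int (n - i) / k) + cos (2 * pi * of_int (n + 1 - i) / k)"
    by (simp add: fan_def inner_add_left inner_dir_dir diff_divide_distrib right_diff_distrib)
  also have "\<dots> = 2 * cos (pi * of_int (2 * (n - i) + 1) / k) * cos (pi / k)"
  proof -
    have "(2 * pi * of_int (n - i) / k + 2 * pi * of_int (n + 1 - i) / k) / 2
        = pi * of_int (2 * (n - i) + 1) / k"
      using assms by (simp add: field_simps)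
    moreover have "(2 * pi * of_int (n - i) / k - 2 * pi * of_int (n + 1 - i) / k) / 2 = - (pi / k)"
      using assms by (simp add: field_simps)
    ultimately show ?thesis
      unfolding cos_plus_cos by simp
  qed
  also have "\<dots> \<le> 2 * cos (pi / k) * cos (pi / k)"
    using cos_odd_multiple_le[of k "2 * (n - i) + 1"] cos_pi_div_pos[OF assms] assms
    by (intro mult_right_mono mult_left_mono) auto
  finally show ?thesis
    using fan_cos_eq[of k] assms by (simp add: power2_eq_square)
qed

lemma sin_two_pi_div_pos:
  assumes "k \<ge> 3"
  shows "sin (2 * pi / real k) > 0"
  using assms by (intro sin_gt_zero) (auto simp: field_simps)

lemma fan_combination:
  assumes "k \<ge> 3"
  shows "dir \<psi> = (sin (\<phi> + 2 * pi * of_int (n + 1) / k - \<psi>) / sin (2 * pi / k)) *\<^sub>R fan k \<phi> n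
    + (sin (\<psi> - (\<phi> + 2 * pi * of_int n / k)) / sin (2 * pi / k)) *\<^sub>R fan k \<phi> (n + 1)"
proof -
  let ?s = "sin (2 * pi / real k)"
  have "\<phi> + 2 * pi * of_int (n + 1) / k - (\<phi> + 2 * pi * of_int n / k) = 2 * pi / k"
    by (simp add: add_divide_distrib[symmetric] algebra_simps)
  with dir_combination[of "\<phi> + 2 * pi * of_int (n + 1) / k" "\<phi> + 2 * pi * of_int n / k" \<psi>]
  have "?s *\<^sub>R dir \<psi> = sin (\<phi> + 2 * pi * of_int (n + 1) / k - \<psi>) *\<^sub>R fan k \<phi> n
    + sin (\<psi> - (\<phi> + 2 * pi * of_int n / k)) *\<^sub>R fan k \<phi> (n + 1)"
    by (simp only: fan_def)
  then have "(1 / ?s) *\<^sub>R (?s *\<^sub>R dir \<psi>) = (1 / ?s) *\<^sub>R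
     (sin (\<phi> + 2 * pi * of_int (n + 1) / k - \<psi>) *\<^sub>R fan k \<phi> n
    + sin (\<psi> - (\<phi> + 2 * pi * of_int n / k)) *\<^sub>R fan k \<phi> (n + 1))"
    by simp
  then show ?thesis
    using sin_two_pi_div_pos[OF assms] by (simp add: scaleR_add_right)
qed

lemma fan_combination_scaled:
  assumes "k \<ge> 3" "y = r *\<^sub>R dir \<psi>"
  shows "y = (r * (sin (\<phi> + 2 * pi * of_int (n + 1) / k - \<psi>) / sin (2 * pi / k))) *\<^sub>R fan k \<phi> n
    + (r * (sin (\<psi> - (\<phi> + 2 * pi * of_int n / k)) / sin (2 * pi / k))) *\<^sub>R fan k \<phi> (n + 1)"
  unfolding assms(2) fan_combination[OF assms(1), of \<psi> \<phi> n] scaleR_add_right scaleR_scaleR ..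

lemma fan_coordinates:
  assumes "k \<ge> 3"
  shows "\<exists>x x'. y = x *\<^sub>R fan k \<phi> n + x' *\<^sub>R fan k \<phi> (n + 1)"
  using polar_form[of y] fan_combination_scaled[OF assms] by blast

text \<open>The plane is covered by the sectors between neighbouring directions; later computations
  take place in one sector.\<close>

lemma fan_sector:
  assumes "k \<ge> 3"
  shows "\<exists>n x x'. 0 \<le> x \<and> 0 \<le> x' \<and> y = x *\<^sub>R fan k \<phi> n + x' *\<^sub>R fan k \<phi> (n + 1)"
proof -
  obtain \<psi> where \<psi>: "y = norm y *\<^sub>R dir \<psi>"
    using polar_form by blast
  \<comment> \<open>With this \<open>n\<close> the angles from \<open>y\<close> to both neighbours
    lie in \<open>[0, pi]\<close>, which makes the two sines nonnegative.\<close>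
  define n where "n = \<lfloor>(\<psi> - \<phi>) * k / (2 * pi)\<rfloor>"
  have "of_int n \<le> (\<psi> - \<phi>) * k / (2 * pi)" "(\<psi> - \<phi>) * k / (2 * pi) \<le> of_int n + 1"
    unfolding n_def by linarith+
  then have n: "\<phi> + 2 * pi * of_int n / k \<le> \<psi>" "\<psi> \<le> \<phi> + 2 * pi * of_int (n + 1) / k"
    using assms by (auto simp: field_simps)
  have w: "\<phi> + 2 * pi * of_int (n + 1) / k - (\<phi> + 2 * pi * of_int n / k) = 2 * pi / k"
    by (simp add: add_divide_distrib[symmetric] algebra_simps)
  have "2 * pi / k \<le> pi"
    using assms by (simp add: field_simps)
  with n w have "sin (\<phi> + 2 * pi * of_int (n + 1) / k - \<psi>) \<ge> 0"
    "sin (\<psi> - (\<phi> + 2 * pi * of_int n / k)) \<ge> 0"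
    by (auto intro!: sin_ge_zero)
  then have "0 \<le> norm y * (sin (\<phi> + 2 * pi * of_int (n + 1) / k - \<psi>) / sin (2 * pi / k))"
    "0 \<le> norm y * (sin (\<psi> - (\<phi> + 2 * pi * of_int n / k)) / sin (2 * pi / k))"
    using sin_two_pi_div_pos[OF assms] by auto
  then show ?thesis
    using fan_combination_scaled[OF assms \<psi>] by blast
qed

section \<open>Frequency functions\<close>

text \<open>Add the two inequalities that belong to the sector of \<open>snd q\<close>: the sum of
  the left-hand sides is nonnegative because \<open>fan_cos k > -1\<close>.\<close>

lemma fan_domain_pos:
  assumes "k \<ge> 3" "q \<in> fan_domain k \<phi>"
  shows "fst q > 0"
proof -
  obtain n x x' where x: "0 \<le> x" "0 \<le> x'"
    "snd q = x *\<^sub>R fan k \<phi> n + x' *\<^sub>R fan k \<phi> (n + 1)"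
    using fan_sector[OF assms(1)] by blast
  have "snd q \<bullet> fan k \<phi> n + snd q \<bullet> fan k \<phi> (n + 1) = (x + x') * (1 + fan_cos k)"
    unfolding x(3) by (simp add: inner_add_left) (simp add: algebra_simps)
  also have "\<dots> \<ge> 0"
    using x fan_cos_bounds[OF assms(1)] by simp
  finally have "0 \<le> snd q \<bullet> fan k \<phi> n + snd q \<bullet> fan k \<phi> (n + 1)" .
  moreover have "snd q \<bullet> fan k \<phi> n < fst q" "snd q \<bullet> fan k \<phi> (n + 1) < fst q"
    using assms(2) by (auto simp: fan_domain_def)
  ultimately show ?thesis
    by linarith
qed

lemma fan_domain_Int:
  assumes "k > 0"
  shows "fan_domain k \<phi> = (\<Inter>n\<in>{0..<int k}. {p. snd p \<bullet> fan k \<phi> n < fst p})"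
  using all_fan_iff[OF assms, of "\<lambda>a b. _ \<bullet> a < _"] by (auto simp: fan_domain_def)

lemma open_fan_domain: "k > 0 \<Longrightarrow> open (fan_domain k \<phi>)"
  unfolding fan_domain_Int by (intro open_INT finite_atLeastLessThan_int ballI open_Collect_less)
    (auto intro!: continuous_intros)

lemma convex_fan_domain: "convex (fan_domain k \<phi>)"
proof -
  have "convex {p :: mink. snd p \<bullet> fan k \<phi> n < fst p}" for n
  proof -
    have "{p :: mink. snd p \<bullet> fan k \<phi> n < fst p} = {p. (-1, fan k \<phi> n) \<bullet> p < 0}"
      by (auto simp: inner_prod_def inner_commute)
    then show ?thesis
      by (simp add: convex_halfspace_lt)
  qed
  then have "convex (\<Inter>n. {p :: mink. snd p \<bullet> fan k \<phi> n < fst p})"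
    by (intro convex_INT) auto
  moreover have "fan_domain k \<phi> = (\<Inter>n. {p. snd p \<bullet> fan k \<phi> n < fst p})"
    by (auto simp: fan_domain_def)
  ultimately show ?thesis
    by simp
qed

lemma timelike_in_fan_domain:
  assumes "norm (snd p) < fst p"
  shows "p \<in> fan_domain k \<phi>"
  unfolding fan_domain_def
  using norm_cauchy_schwarz[of "snd p" "fan k \<phi> _"] assms by (auto intro: order.strict_trans1)

text \<open>The case of \<open>graph_fun_eqI\<close> with foot point 0 and
  \<open>\<epsilon> N = (t, z)\<close>. Here \<open>cone\<close> places the ray in \<open>D\<close>,
  and \<open>dual\<close> says that the plane through 0 orthogonal to \<open>N\<close> supports
  \<open>D\<close>.\<close>

lemma graph_fun_hyperboloid:
  assumes D: "convex D" "open D" "\<And>q. q \<in> D \<Longrightarrow> fst q \<ge> 0"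
    and cone: "\<And>q. norm (snd q) < fst q \<Longrightarrow> q \<in> D" and "\<epsilon> > 0"
    and dual: "\<And>q. q \<in> D \<Longrightarrow> z \<bullet> snd q \<le> sqrt (\<epsilon>\<^sup>2 + z \<bullet> z) * fst q"
  shows "graph_fun D \<epsilon> z = sqrt (\<epsilon>\<^sup>2 + z \<bullet> z)"
proof -
  define t where "t = sqrt (\<epsilon>\<^sup>2 + z \<bullet> z)"
  have t: "t\<^sup>2 = \<epsilon>\<^sup>2 + z \<bullet> z" "t > 0"
    using \<open>\<epsilon> > 0\<close> by (auto simp: t_def add_pos_nonneg)
  have zt: "norm z < t"
    unfolding t_def norm_eq_sqrt_inner using \<open>\<epsilon> > 0\<close> by (intro real_sqrt_less_mono) simp
  let ?N = "(1 / \<epsilon>) *\<^sub>R (t, z)"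
  show ?thesis
    unfolding t_def[symmetric]
  proof (rule graph_fun_eqI[OF D, where N = ?N and r = 0])
    have "mform (t, z) (t, z) = - \<epsilon>\<^sup>2"
      using t by (simp add: mform_def power2_eq_square)
    then show "mform ?N ?N = -1"
      unfolding mform_scaleR_left mform_scaleR_right using \<open>\<epsilon> > 0\<close>
      by (simp add: power2_eq_square)
    show "fst ?N > 0"
      using t \<open>\<epsilon> > 0\<close> by simp
    show "mform ?N (q - 0) \<le> 0" if "q \<in> D" for q
      using dual[OF that] \<open>\<epsilon> > 0\<close> unfolding t_def[symmetric] mform_scaleR_left diff_zero
      by (simp add: mform_def divide_le_0_iff)
    show "0 + \<sigma> *\<^sub>R ?N \<in> D" if "0 < \<sigma>" for \<sigma>
      using that zt \<open>\<epsilon> > 0\<close> by (intro cone) (simp add: divide_strict_right_mono)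
    show "0 + \<epsilon> *\<^sub>R ?N = (t, z)"
      using \<open>\<epsilon> > 0\<close> by simp
  qed (use \<open>\<epsilon> > 0\<close> in auto)
qed

lemma frequency_eqI:
  assumes "\<forall>\<^sub>F \<epsilon> in at_right 0. freq_eps D \<epsilon> y = F \<epsilon>" "(F \<longlongrightarrow> l) (at_right 0)"
  shows "frequency D y = l"
proof -
  have "((\<lambda>\<epsilon>. freq_eps D \<epsilon> y) \<longlongrightarrow> l) (at_right 0)"
    using assms by (simp add: tendsto_cong)
  then show ?thesis
    unfolding frequency_def by (intro tendsto_Lim) simp
qed

text \<open>The gradient \<open>y / S\<close> gives
  \<open>1 - \<bar>g\<bar>^2 = (\<epsilon> / S)^2\<close>, so \<open>freq_eps\<close> equals
  \<open>S\<close> and tends to \<open>norm y\<close>. The neighbourhood in the hypothesis may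
  shrink with \<open>\<epsilon>\<close>.\<close>

lemma frequency_hyperboloid:
  assumes "\<And>\<epsilon>. \<epsilon> > 0 \<Longrightarrow> \<forall>\<^sub>F z in nhds y. graph_fun D \<epsilon> z = sqrt (\<epsilon>\<^sup>2 + z \<bullet> z)"
  shows "frequency D y = norm y"
proof (rule frequency_eqI)
  show "\<forall>\<^sub>F \<epsilon> in at_right 0. freq_eps D \<epsilon> y = sqrt (\<epsilon>\<^sup>2 + y \<bullet> y)"
    unfolding eventually_at_filter
  proof (intro always_eventually allI impI)
    fix \<epsilon> :: real assume "\<epsilon> \<in> {0<..}"
    then have "\<epsilon> > 0" by simp
    define S where "S = sqrt (\<epsilon>\<^sup>2 + y \<bullet> y)"
    have pos: "\<epsilon>\<^sup>2 + y \<bullet> y > 0"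
      using \<open>\<epsilon> > 0\<close> by (simp add: add_pos_nonneg)
    then have S: "S > 0" "S\<^sup>2 = \<epsilon>\<^sup>2 + y \<bullet> y"
      by (auto simp: S_def)
    let ?g = "(1 / S) *\<^sub>R y"
    have deriv: "((\<lambda>z. sqrt (\<epsilon>\<^sup>2 + z \<bullet> z)) has_derivative (\<lambda>h. ?g \<bullet> h)) (at y)"
      using pos S
      by (auto intro!: derivative_eq_intros simp: S_def fun_eq_iff inner_commute field_simps)
    have g: "1 - ?g \<bullet> ?g = (\<epsilon> / S)\<^sup>2"
    proof -
      have yy: "y \<bullet> y = S\<^sup>2 - \<epsilon>\<^sup>2"
        using S(2) by simp
      have "1 - ?g \<bullet> ?g = 1 - (y \<bullet> y) / S\<^sup>2"
        by (simp add: power2_eq_square)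
      then show ?thesis
        unfolding yy using S(1) by (simp add: field_simps)
    qed
    have "(\<epsilon> / S)\<^sup>2 > 0"
      using \<open>\<epsilon> > 0\<close> S by simp
    then have lt: "?g \<bullet> ?g < 1"
      using g by linarith
    have "freq_eps D \<epsilon> y = \<epsilon> / sqrt ((\<epsilon> / S)\<^sup>2)"
      unfolding g[symmetric] by (rule freq_eps_eq[OF assms[OF \<open>\<epsilon> > 0\<close>] deriv lt])
    also have "\<dots> = S"
      using \<open>\<epsilon> > 0\<close> S by simp
    finally show "freq_eps D \<epsilon> y = sqrt (\<epsilon>\<^sup>2 + y \<bullet> y)"
      by (simp add: S_def)
  qed
  have "((\<lambda>\<epsilon>. sqrt (\<epsilon>\<^sup>2 + y \<bullet> y)) \<longlongrightarrow> sqrt (0\<^sup>2 + y \<bullet> y)) (at_right 0)"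
    by (intro tendsto_intros)
  then show "((\<lambda>\<epsilon>. sqrt (\<epsilon>\<^sup>2 + y \<bullet> y)) \<longlongrightarrow> norm y) (at_right 0)"
    by (simp add: norm_eq_sqrt_inner)
qed

section \<open>Frequency function of the light cone\<close>

lemma Iplus_0: "Iplus {0} = {p. norm (snd p) < fst p}"
  by (auto simp: Iplus_def future_timelike_iff)

lemma frequency_Iplus_0: "frequency (Iplus {0}) y = norm y"
proof (rule frequency_hyperboloid, intro always_eventually allI graph_fun_hyperboloid)
  have "Iplus {0 :: mink} = {p. norm (snd p) < fst p}"
    by (rule Iplus_0)
  then show "open (Iplus {0 :: mink})"
    by (auto intro!: open_Collect_less continuous_intros)
  show "convex (Iplus {0 :: mink})"
    unfolding convex_alt
  proof (intro ballI allI impI)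
    fix p q :: mink and u :: real
    assume *: "p \<in> Iplus {0}" "q \<in> Iplus {0}" "0 \<le> u \<and> u \<le> 1"
    have "norm (snd ((1 - u) *\<^sub>R p + u *\<^sub>R q)) \<le> (1 - u) * norm (snd p) + u * norm (snd q)"
      using * norm_triangle_ineq[of "(1 - u) *\<^sub>R snd p" "u *\<^sub>R snd q"] by simp
    also have "\<dots> < (1 - u) * fst p + u * fst q"
    proof (cases "u = 0")
      case False
      with * show ?thesis
        by (intro add_le_less_mono mult_left_mono mult_strict_left_mono) (auto simp: Iplus_0)
    qed (use * in \<open>auto simp: Iplus_0\<close>)
    finally show "(1 - u) *\<^sub>R p + u *\<^sub>R q \<in> Iplus {0}"
      by (simp add: Iplus_0)
  qed
  fix \<epsilon> :: real and z :: "real^2" and q :: mink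
  assume q: "q \<in> Iplus {0}"
  show "0 \<le> fst q"
    using q norm_ge_zero[of "snd q"] by (auto simp: Iplus_0 simp del: norm_ge_zero)
  have "z \<bullet> snd q \<le> norm z * norm (snd q)"
    by (rule norm_cauchy_schwarz)
  also have "\<dots> \<le> sqrt (\<epsilon>\<^sup>2 + z \<bullet> z) * fst q"
    using q by (intro mult_mono) (auto simp: Iplus_0 norm_eq_sqrt_inner)
  finally show "z \<bullet> snd q \<le> sqrt (\<epsilon>\<^sup>2 + z \<bullet> z) * fst q" .
qed (auto simp: Iplus_0)

section \<open>Frequency function of the polygonal domain, on the rays and inside the
  sectors\<close>

text \<open>A weighted sum of two instances of \<open>fan_mid_inner_le\<close>. Equality holds for
  \<open>i = n\<close>, so the product with \<open>e_i + e_(i+1)\<close> is largest on the sector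
  that contains the point.\<close>

lemma fan_sector_mid_le:
  assumes "k \<ge> 3" "0 \<le> x" "0 \<le> x'"
  shows "(x *\<^sub>R fan k \<phi> n + x' *\<^sub>R fan k \<phi> (n + 1)) \<bullet> (fan k \<phi> i + fan k \<phi> (i + 1))
    \<le> (x + x') * (1 + fan_cos k)"
proof -
  have "x * (fan k \<phi> n \<bullet> (fan k \<phi> i + fan k \<phi> (i + 1))) \<le> x * (1 + fan_cos k)"
    "x' * (fan k \<phi> (n + 1) \<bullet> (fan k \<phi> i + fan k \<phi> (i + 1))) \<le> x' * (1 + fan_cos k)"
    using assms fan_mid_inner_le[OF assms(1), of \<phi> i]
    by (auto intro!: mult_left_mono simp: inner_commute[of "fan k \<phi> n"] inner_commute[of "fan k \<phi> (n + 1)"])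
  then show ?thesis
    by (simp add: inner_add_left algebra_simps)
qed

text \<open>For fixed \<open>\<epsilon>\<close> the foot point of every point near the ray point is
  the apex 0, so the level surface is locally the hyperboloid.\<close>

lemma frequency_fan_ray:
  assumes "k \<ge> 3" "a \<ge> 0"
  shows "frequency (fan_domain k \<phi>) (a *\<^sub>R fan k \<phi> m) = a"
proof -
  let ?y = "a *\<^sub>R fan k \<phi> m" and ?c = "1 + fan_cos k"
  have c: "?c > 0"
    using fan_cos_bounds[OF assms(1)] by simp
  have "frequency (fan_domain k \<phi>) ?y = norm ?y"
  proof (rule frequency_hyperboloid)
    fix \<epsilon> :: real assume "\<epsilon> > 0"
    \<comment> \<open>This encodes \<open>x + x' < sqrt (\<epsilon>^2 + \<bar>z\<bar>^2)\<close> for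
      the sector coordinates of \<open>z\<close>. It is stated for all \<open>n\<close> because
      nearby \<open>z\<close> fall into different sectors.\<close>
    have "\<forall>\<^sub>F z in nhds ?y. \<forall>n\<in>{0..<int k}.
      z \<bullet> (fan k \<phi> n + fan k \<phi> (n + 1)) < ?c * sqrt (\<epsilon>\<^sup>2 + z \<bullet> z)"
    proof (intro eventually_ball_finite finite_atLeastLessThan_int ballI)
      fix n
      have "a = sqrt (a\<^sup>2)"
        using assms by simp
      also have "\<dots> < sqrt (\<epsilon>\<^sup>2 + ?y \<bullet> ?y)"
        unfolding real_sqrt_less_iff using \<open>\<epsilon> > 0\<close> by (simp add: power2_eq_square)
      finally have "a * ?c < ?c * sqrt (\<epsilon>\<^sup>2 + ?y \<bullet> ?y)"
        using c by (simp add: mult.commute)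
      then have "?y \<bullet> (fan k \<phi> n + fan k \<phi> (n + 1)) < ?c * sqrt (\<epsilon>\<^sup>2 + ?y \<bullet> ?y)"
        using fan_sector_mid_le[OF assms(1,2), of 0 \<phi> m n] by simp
      moreover have "open {z. z \<bullet> (fan k \<phi> n + fan k \<phi> (n + 1)) < ?c * sqrt (\<epsilon>\<^sup>2 + z \<bullet> z)}"
        by (intro open_Collect_less continuous_intros)
      ultimately show "\<forall>\<^sub>F z in nhds ?y.
        z \<bullet> (fan k \<phi> n + fan k \<phi> (n + 1)) < ?c * sqrt (\<epsilon>\<^sup>2 + z \<bullet> z)"
        using eventually_nhds by blast
    qed
    then show "\<forall>\<^sub>F z in nhds ?y. graph_fun (fan_domain k \<phi>) \<epsilon> z = sqrt (\<epsilon>\<^sup>2 + z \<bullet> z)"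
    proof eventually_elim
      case (elim z)
      then have *: "z \<bullet> (fan k \<phi> n + fan k \<phi> (n + 1)) < ?c * sqrt (\<epsilon>\<^sup>2 + z \<bullet> z)" for n
        using all_fan_iff[of k "\<lambda>a b. z \<bullet> (a + b) < ?c * sqrt (\<epsilon>\<^sup>2 + z \<bullet> z)"] assms by auto
      show ?case
      proof (rule graph_fun_hyperboloid)
        fix q assume q: "q \<in> fan_domain k \<phi>"
        obtain n x x' where x: "0 \<le> x" "0 \<le> x'" "z = x *\<^sub>R fan k \<phi> n + x' *\<^sub>R fan k \<phi> (n + 1)"
          using fan_sector[OF assms(1)] by blast
        have "z \<bullet> (fan k \<phi> n + fan k \<phi> (n + 1)) = ?c * (x + x')"
          unfolding x(3) by (simp add: inner_add_left inner_add_right) (simp add: algebra_simps)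
        with *[of n] c have le: "x + x' \<le> sqrt (\<epsilon>\<^sup>2 + z \<bullet> z)"
          by simp
        have "fan k \<phi> n \<bullet> snd q \<le> fst q" "fan k \<phi> (n + 1) \<bullet> snd q \<le> fst q"
          using q by (auto simp: fan_domain_def less_imp_le inner_commute)
        then have "z \<bullet> snd q \<le> x * fst q + x' * fst q"
          using x(1,2) unfolding x(3)
          by (auto simp: inner_add_left intro!: add_mono mult_left_mono)
        also have "\<dots> \<le> sqrt (\<epsilon>\<^sup>2 + z \<bullet> z) * fst q"
          using mult_right_mono[OF le, of "fst q"] fan_domain_pos[OF assms(1) q]
          by (simp add: algebra_simps)
        finally show "z \<bullet> snd q \<le> sqrt (\<epsilon>\<^sup>2 + z \<bullet> z) * fst q" .
      qed (use assms fan_domain_pos[OF assms(1)] \<open>\<epsilon> > 0\<close> in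
          \<open>auto intro: convex_fan_domain open_fan_domain timelike_in_fan_domain less_imp_le\<close>)
    qed
  qed
  with assms show ?thesis by simp
qed

text \<open>
  For points near the ridge in which the faces with normals \<open>e\<^sub>n\<close> and \<open>e\<^sub>n\<^sub>+\<^sub>1\<close> meet, the foot point
  \<open>r\<close> lies on that ridge, and \<open>\<epsilon> N\<close> is a combination of the two lightlike normals.
\<close>

lemma graph_fun_ridge:
  fixes n :: int
  assumes k: "k \<ge> 3" and "\<epsilon> > 0"
    and A: "z \<bullet> fan k \<phi> n < t" and B: "z \<bullet> fan k \<phi> (n + 1) < t"
    and AB: "(1 + fan_cos k) * t < z \<bullet> (fan k \<phi> n + fan k \<phi> (n + 1))"
    and eq: "(t - z \<bullet> fan k \<phi> n) * (t - z \<bullet> fan k \<phi> (n + 1)) = (1 - fan_cos k) / 2 * \<epsilon>\<^sup>2"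
  shows "graph_fun (fan_domain k \<phi>) \<epsilon> z = t"
proof -
  define e e' c where "e = fan k \<phi> n" "e' = fan k \<phi> (n + 1)" "c = fan_cos k"
  note d = this
  have ee [simp]: "e \<bullet> e = 1" "e' \<bullet> e' = 1" "e \<bullet> e' = c" "e' \<bullet> e = c"
    by (simp_all add: d)
  have c: "-1 < c" "c < 1"
    using fan_cos_bounds[OF k] by (simp_all add: d)
  obtain x x' where z: "z = x *\<^sub>R e + x' *\<^sub>R e'"
    using fan_coordinates[OF k] unfolding d by blast
  \<comment> \<open>These solve \<open>(t, z) = s (1 + c, e + e') + l (1, e) + m (1, e')\<close>, a
    ridge point plus a combination of the two lightlike normals. Positivity of \<open>l\<close>,
    \<open>m\<close>, \<open>s\<close> comes from \<open>B\<close>, \<open>A\<close>,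
    \<open>AB\<close> respectively.\<close>
  define l m s where "l = (t - z \<bullet> e') / (1 - c)" "m = (t - z \<bullet> e) / (1 - c)"
    "s = (x + x' - t) / (1 - c)"
  note d' = this
  have ze: "z \<bullet> e = x + c * x'" "z \<bullet> e' = c * x + x'"
    by (simp_all add: z inner_add_left)
  have l: "l > 0" "m > 0"
    using A B c by (simp_all add: d' d)
  have "(1 + c) * t < (1 + c) * (x + x')"
    using AB unfolding d[symmetric] inner_add_right ze by (simp add: algebra_simps)
  then have s: "s > 0"
    using c by (simp add: d')
  have mult: "s * (1 - c) = x + x' - t" "l * (1 - c) = t - (c * x + x')" "m * (1 - c) = t - (x + c * x')"
    using c by (simp_all add: d' ze)
  have "(s + l) * (1 - c) = x * (1 - c)" "(s + m) * (1 - c) = x' * (1 - c)"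
    unfolding distrib_right mult by (simp_all add: algebra_simps)
  moreover have "(s * (1 + c) + (l + m)) * (1 - c) = s * (1 - c) * (1 + c) + (l * (1 - c) + m * (1 - c))"
    by (simp add: algebra_simps)
  then have "(s * (1 + c) + (l + m)) * (1 - c) = t * (1 - c)"
    unfolding mult by (simp add: algebra_simps)
  ultimately have xs: "x = s + l" "x' = s + m" "t = s * (1 + c) + (l + m)"
    using c by simp_all
  \<comment> \<open>The left-hand side is minus the Minkowski square of
    \<open>l (1, e) + m (1, e')\<close>, so \<open>eq\<close> normalises this vector to length
    \<open>\<epsilon>\<close>.\<close>
  have lm: "2 * (l * m) * (1 - c) = \<epsilon>\<^sup>2"
  proof -
    have "t - z \<bullet> e = m * (1 - c)" "t - z \<bullet> e' = l * (1 - c)"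
      using c by (simp_all add: d')
    with eq have "(m * (1 - c)) * (l * (1 - c)) = (1 - c) / 2 * \<epsilon>\<^sup>2"
      by (simp only: d)
    then have "(1 - c) * (2 * (l * m) * (1 - c)) = (1 - c) * \<epsilon>\<^sup>2"
      by (simp add: algebra_simps)
    then show ?thesis
      using c by simp
  qed
  define V r :: mink where "V = (l + m, l *\<^sub>R e + m *\<^sub>R e')" "r = (s * (1 + c), s *\<^sub>R (e + e'))"
  note dV = this
  let ?N = "(1 / \<epsilon>) *\<^sub>R V"
  show ?thesis
  proof (rule graph_fun_eqI[where N = ?N and r = r])
    have "mform V V = - (2 * (l * m) * (1 - c))"
      by (simp add: mform_def dV inner_add_left inner_add_right algebra_simps)
    then have "mform V V = - \<epsilon>\<^sup>2"
      unfolding lm .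
    then show "mform ?N ?N = -1"
      unfolding mform_scaleR_left mform_scaleR_right using \<open>\<epsilon> > 0\<close>
      by (simp add: power2_eq_square)
    show "fst ?N > 0"
      using l \<open>\<epsilon> > 0\<close> by (simp add: dV)
    show "r + \<epsilon> *\<^sub>R ?N = (t, z)"
    proof -
      have "r + V = (t, z)"
        unfolding dV z by (simp add: xs algebra_simps)
      then show ?thesis
        using \<open>\<epsilon> > 0\<close> by simp
    qed
    fix q assume "q \<in> fan_domain k \<phi>"
    then have "snd q \<bullet> e < fst q" "snd q \<bullet> e' < fst q"
      by (auto simp: fan_domain_def d)
    then have "l * (snd q \<bullet> e) + m * (snd q \<bullet> e') \<le> l * fst q + m * fst q"
      using l by (intro add_mono mult_left_mono) auto
    then have "mform V q \<le> 0"
      by (simp add: mform_def dV inner_add_left inner_commute[of e] inner_commute[of e'] algebra_simps)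
    moreover have "mform V r = 0"
      by (simp add: mform_def dV inner_add_left inner_add_right algebra_simps)
    ultimately show "mform ?N (q - r) \<le> 0"
      using \<open>\<epsilon> > 0\<close> by (simp add: mform_simps divide_le_0_iff)
  next
    fix \<sigma> :: real assume "0 < \<sigma>"
    have "snd (r + \<sigma> *\<^sub>R ?N) \<bullet> fan k \<phi> i < fst (r + \<sigma> *\<^sub>R ?N)" for i
    proof -
      let ?a = "e \<bullet> fan k \<phi> i" and ?b = "e' \<bullet> fan k \<phi> i"
      have ab: "?a + ?b \<le> 1 + c"
        using fan_mid_inner_le[OF k, of \<phi> n i] by (simp add: d inner_add_left)
      have 1: "?a \<le> 1" "?b \<le> 1"
        using norm_cauchy_schwarz[of e "fan k \<phi> i"] norm_cauchy_schwarz[of e' "fan k \<phi> i"]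
        by (simp_all add: d)
      \<comment> \<open>The inequality is strict since \<open>?a + ?b \<le> 1 + c < 2\<close>
        prevents both products from being 1.\<close>
      have "l * ?a + m * ?b < l + m"
      proof (cases "?a < 1")
        case True
        then have "l * ?a < l" "m * ?b \<le> m"
          using l 1 by (simp_all add: mult_left_le)
        then show ?thesis by simp
      next
        case False
        then have "?b < 1"
          using ab c by linarith
        then have "l * ?a \<le> l" "m * ?b < m"
          using l 1 by (simp_all add: mult_left_le)
        then show ?thesis by simp
      qed
      then have "(\<sigma> / \<epsilon>) * (l * ?a + m * ?b) < (\<sigma> / \<epsilon>) * (l + m)"
        using \<open>0 < \<sigma>\<close> \<open>\<epsilon> > 0\<close> by (intro mult_strict_left_mono) auto
      moreover have "s * (?a + ?b) \<le> s * (1 + c)"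
        using s ab by (intro mult_left_mono) auto
      ultimately have "s * (?a + ?b) + (\<sigma> / \<epsilon>) * (l * ?a + m * ?b) < s * (1 + c) + (\<sigma> / \<epsilon>) * (l + m)"
        by linarith
      then show ?thesis
        by (simp add: dV inner_add_left)
    qed
    then show "r + \<sigma> *\<^sub>R ?N \<in> fan_domain k \<phi>"
      by (simp add: fan_domain_def)
  qed (use k fan_domain_pos[OF k] \<open>\<epsilon> > 0\<close> in
      \<open>auto intro: convex_fan_domain open_fan_domain less_imp_le\<close>)
qed

text \<open>Inside a sector the foot point lies on the ridge once \<open>\<epsilon>\<close> is
  small. In terms of the half sum \<open>p\<close> and half difference \<open>q\<close>, the larger
  root of the quadratic equation in \<open>graph_fun_ridge\<close> is \<open>U\<close>; then
  \<open>freq_eps\<close> is \<open>S / \<kappa>\<close>, with limit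
  \<open>\<bar>x - x'\<bar>\<close>.\<close>

lemma frequency_fan_interior:
  fixes n :: int
  assumes k: "k \<ge> 3" and x: "0 < x" "0 < x'"
  shows "frequency (fan_domain k \<phi>) (x *\<^sub>R fan k \<phi> n + x' *\<^sub>R fan k \<phi> (n + 1)) = \<bar>x - x'\<bar>"
proof -
  define e e' c where "e = fan k \<phi> n" "e' = fan k \<phi> (n + 1)" "c = fan_cos k"
  note d = this
  have ee [simp]: "e \<bullet> e = 1" "e' \<bullet> e' = 1" "e \<bullet> e' = c" "e' \<bullet> e = c"
    by (simp_all add: d)
  have c: "-1 < c" "c < 1"
    using fan_cos_bounds[OF k] by (simp_all add: d)
  define \<kappa> where "\<kappa> = (1 - c) / 2"
  have \<kappa>: "0 < \<kappa>" "\<kappa> < 1"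
    using c by (simp_all add: \<kappa>_def)
  define p q where "p = (1 / 2) *\<^sub>R (e + e')" "q = (1 / 2) *\<^sub>R (e - e')"
  note dp = this
  have pq [simp]: "p \<bullet> p = 1 - \<kappa>" "q \<bullet> q = \<kappa>" "p \<bullet> q = 0" "q \<bullet> p = 0"
    by (simp_all add: dp inner_add_left inner_add_right inner_diff_left inner_diff_right \<kappa>_def field_simps)
  define S U where "S = (\<lambda>\<epsilon> z. sqrt ((z \<bullet> q)\<^sup>2 + \<kappa> * \<epsilon>\<^sup>2))" "U = (\<lambda>\<epsilon> z. z \<bullet> p + S \<epsilon> z)"
  note dS = this
  define y where "y = x *\<^sub>R e + x' *\<^sub>R e'"
  have yp: "y \<bullet> p = (x + x') * (1 - \<kappa>)" and yq: "y \<bullet> q = (x - x') * \<kappa>"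
    by (simp_all add: y_def dp inner_add_left inner_add_right inner_diff_left inner_diff_right \<kappa>_def field_simps)
  have S_pos: "S \<epsilon> z > \<bar>z \<bullet> q\<bar>" if "\<epsilon> > 0" for \<epsilon> z
  proof -
    have "sqrt ((z \<bullet> q)\<^sup>2) < S \<epsilon> z"
      unfolding dS real_sqrt_less_iff using \<kappa> that by simp
    then show ?thesis by simp
  qed
  \<comment> \<open>The condition \<open>zp\<close> is half of the inequality \<open>AB\<close> of
    \<open>graph_fun_ridge\<close>; for fixed \<open>\<epsilon>\<close> it is open in
    \<open>z\<close>.\<close>
  have graph: "graph_fun (fan_domain k \<phi>) \<epsilon> z = U \<epsilon> z"
    if "\<epsilon> > 0" and zp: "(1 - \<kappa>) * U \<epsilon> z < z \<bullet> p" for \<epsilon> z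
  proof (rule graph_fun_ridge[OF k \<open>\<epsilon> > 0\<close>, of _ _ n]; unfold d[symmetric])
    have ze: "z \<bullet> e = z \<bullet> p + z \<bullet> q" "z \<bullet> e' = z \<bullet> p - z \<bullet> q"
      by (simp_all add: dp inner_add_right inner_diff_right field_simps)
    show "z \<bullet> e < U \<epsilon> z" "z \<bullet> e' < U \<epsilon> z"
      using S_pos[OF \<open>\<epsilon> > 0\<close>, of z] unfolding ze dS(2) by auto
    show "(1 + c) * U \<epsilon> z < z \<bullet> (e + e')"
    proof -
      have "2 * (z \<bullet> p) = z \<bullet> (e + e')" "2 * ((1 - \<kappa>) * U \<epsilon> z) = (1 + c) * U \<epsilon> z"
        by (simp_all add: \<kappa>_def dp inner_add_right field_simps)
      with zp show ?thesis by linarith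
    qed
    have "(U \<epsilon> z - z \<bullet> e) * (U \<epsilon> z - z \<bullet> e') = (S \<epsilon> z)\<^sup>2 - (z \<bullet> q)\<^sup>2"
      unfolding ze dS(2) by (simp add: power2_eq_square algebra_simps)
    also have "\<dots> = \<kappa> * \<epsilon>\<^sup>2"
      using \<kappa> by (simp add: dS)
    finally show "(U \<epsilon> z - z \<bullet> e) * (U \<epsilon> z - z \<bullet> e') = (1 - c) / 2 * \<epsilon>\<^sup>2"
      by (simp add: \<kappa>_def)
  qed
  have lim: "((\<lambda>\<epsilon>. S \<epsilon> y) \<longlongrightarrow> \<bar>x - x'\<bar> * \<kappa>) (at_right 0)"
  proof -
    have "((\<lambda>\<epsilon>. S \<epsilon> y) \<longlongrightarrow> sqrt ((y \<bullet> q)\<^sup>2 + \<kappa> * 0\<^sup>2)) (at_right 0)"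
      unfolding dS by (intro tendsto_intros)
    then show ?thesis
      using \<kappa> by (simp add: yq abs_mult)
  qed
  have "frequency (fan_domain k \<phi>) y = \<bar>x - x'\<bar>"
  proof (rule frequency_eqI)
    have "((\<lambda>\<epsilon>. (1 - \<kappa>) * U \<epsilon> y) \<longlongrightarrow> (1 - \<kappa>) * (y \<bullet> p + \<bar>x - x'\<bar> * \<kappa>)) (at_right 0)"
      unfolding dS(2) by (intro tendsto_intros lim)
    \<comment> \<open>Strict because both coordinates are positive. On the rays this becomes an
      equality, hence their separate treatment.\<close>
    moreover have "(1 - \<kappa>) * (y \<bullet> p + \<bar>x - x'\<bar> * \<kappa>) < y \<bullet> p"
    proof -
      have "\<bar>x - x'\<bar> * \<kappa> < (x + x') * \<kappa>"
        using x \<kappa> by (intro mult_strict_right_mono) auto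
      then have "y \<bullet> p + \<bar>x - x'\<bar> * \<kappa> < x + x'"
        unfolding yp by (simp add: algebra_simps)
      then show ?thesis
        using \<kappa> by (simp add: yp mult.commute)
    qed
    ultimately have "\<forall>\<^sub>F \<epsilon> in at_right 0. (1 - \<kappa>) * U \<epsilon> y < y \<bullet> p"
      by (rule order_tendstoD)
    moreover have "\<forall>\<^sub>F \<epsilon> in at_right 0. \<epsilon> > (0 :: real)"
      by (simp add: eventually_at_filter)
    ultimately show "\<forall>\<^sub>F \<epsilon> in at_right 0. freq_eps (fan_domain k \<phi>) \<epsilon> y = S \<epsilon> y / \<kappa>"
    proof eventually_elim
      case (elim \<epsilon>)
      have "open {z. (1 - \<kappa>) * U \<epsilon> z < z \<bullet> p}"
        unfolding dS by (intro open_Collect_less continuous_intros)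
      with elim have "\<forall>\<^sub>F z in nhds y. (1 - \<kappa>) * U \<epsilon> z < z \<bullet> p"
        using eventually_nhds by blast
      then have ev: "\<forall>\<^sub>F z in nhds y. graph_fun (fan_domain k \<phi>) \<epsilon> z = U \<epsilon> z"
        by eventually_elim (use graph elim in auto)
      define w where "w = S \<epsilon> y"
      have w: "w > 0" "w\<^sup>2 = (y \<bullet> q)\<^sup>2 + \<kappa> * \<epsilon>\<^sup>2" "(y \<bullet> q)\<^sup>2 + \<kappa> * \<epsilon>\<^sup>2 > 0"
        using S_pos[OF elim(2), of y] \<kappa> elim(2) by (auto simp: w_def dS add_nonneg_pos)
      let ?g = "p + (y \<bullet> q / w) *\<^sub>R q"
      have deriv: "(U \<epsilon> has_derivative (\<lambda>h. ?g \<bullet> h)) (at y)"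
        unfolding dS using w(3)
        by (auto intro!: derivative_eq_intros
            simp: w_def dS fun_eq_iff inner_commute inner_add_right field_simps)
      have g: "1 - ?g \<bullet> ?g = (\<kappa> * \<epsilon> / w)\<^sup>2"
      proof -
        have yq2: "(y \<bullet> q)\<^sup>2 = w\<^sup>2 - \<kappa> * \<epsilon>\<^sup>2"
          using w(2) by simp
        have "1 - ?g \<bullet> ?g = \<kappa> * (1 - (y \<bullet> q)\<^sup>2 / w\<^sup>2)"
          by (simp add: inner_add_left inner_add_right power2_eq_square algebra_simps)
        also have "\<dots> = (\<kappa> * \<epsilon> / w)\<^sup>2"
          unfolding yq2 using w(1) by (simp add: field_simps power2_eq_square)
        finally show ?thesis .
      qed
      have "(\<kappa> * \<epsilon> / w)\<^sup>2 > 0"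
        using \<kappa> elim(2) w(1) by simp
      then have lt: "?g \<bullet> ?g < 1"
        using g by linarith
      have "freq_eps (fan_domain k \<phi>) \<epsilon> y = \<epsilon> / sqrt ((\<kappa> * \<epsilon> / w)\<^sup>2)"
        unfolding g[symmetric] by (rule freq_eps_eq[OF ev deriv lt])
      also have "\<dots> = w / \<kappa>"
        using \<kappa> elim(2) w(1) by simp
      finally show ?case
        by (simp add: w_def)
    qed
    show "((\<lambda>\<epsilon>. S \<epsilon> y / \<kappa>) \<longlongrightarrow> \<bar>x - x'\<bar>) (at_right 0)"
      using tendsto_divide[OF lim tendsto_const, of \<kappa>] \<kappa> by simp
  qed
  then show ?thesis
    by (simp add: y_def d)
qed

lemma frequency_fan_domain:
  fixes n :: int
  assumes k: "k \<ge> 3" and x: "0 \<le> x" "0 \<le> x'"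
  shows "frequency (fan_domain k \<phi>) (x *\<^sub>R fan k \<phi> n + x' *\<^sub>R fan k \<phi> (n + 1)) = \<bar>x - x'\<bar>"
proof -
  consider "x = 0" | "x' = 0" | "0 < x" "0 < x'"
    using x by linarith
  then show ?thesis
    by cases (use frequency_fan_ray[OF k] frequency_fan_interior[OF k] x in auto)
qed

section \<open>The domain of a circumscribed polygon\<close>

lemma light_circle_eq: "light_circle = {p. fst p = 1 \<and> norm (snd p) = 1}"
proof -
  have I: "Iplus {0 :: mink} = {p. norm (snd p) < fst p}"
    by (rule Iplus_0)
  have op: "open (Iplus {0 :: mink})"
    unfolding I by (auto intro!: open_Collect_less continuous_intros)
  have "closed {p :: mink. norm (snd p) \<le> fst p}"
    by (intro closed_Collect_le continuous_intros)
  then have cl: "closure (Iplus {0 :: mink}) \<subseteq> {p. norm (snd p) \<le> fst p}"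
    unfolding I by (intro closure_minimal) auto
  have "(1, y) \<in> closure (Iplus {0})" if "norm y = 1" for y :: "real^2"
    unfolding closure_approachable
  proof (intro allI impI)
    fix d :: real assume "d > 0"
    with that show "\<exists>q\<in>Iplus {0}. dist q (1, y) < d"
      by (intro bexI[of _ "(1 + d / 2, y)"]) (auto simp: I dist_Pair_Pair dist_real_def)
  qed
  then show ?thesis
    unfolding light_circle_def frontier_def interior_open[OF op] using cl
    by (force simp: I)
qed

text \<open>A point of the half-space lies above \<open>(snd p \<bullet> e, snd p)\<close> on the
  plane, and a vertical step is timelike. The converse is Cauchy-Schwarz.\<close>

lemma Iplus_lightlike_plane:
  assumes "norm e = 1"
  shows "Iplus {x. mform x (1, e) = 0} = {p. snd p \<bullet> e < fst p}"
proof (intro equalityI subsetI CollectI)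
  fix p assume "p \<in> Iplus {x. mform x (1, e) = 0}"
  then obtain a where a: "mform a (1, e) = 0" "norm (snd (p - a)) < fst (p - a)"
    by (auto simp: Iplus_def future_timelike_iff)
  have "snd (p - a) \<bullet> e \<le> norm (snd (p - a))"
    using norm_cauchy_schwarz[of "snd (p - a)" e] assms by simp
  with a show "snd p \<bullet> e < fst p"
    by (simp add: mform_def inner_diff_left)
next
  fix p :: mink assume "p \<in> {p. snd p \<bullet> e < fst p}"
  then show "p \<in> Iplus {x. mform x (1, e) = 0}"
    unfolding Iplus_def future_timelike_iff mem_Collect_eq
    by (intro bexI[of _ "(snd p \<bullet> e, snd p)"]) (simp_all add: mform_def)
qed

text \<open>Two orthogonal null vectors are parallel: the normal of \<open>P\<close> is null and
  orthogonal to \<open>(1, e)\<close>, hence a nonzero multiple of it. One contact point therefore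
  determines the plane.\<close>

lemma lightlike_plane_eq:
  assumes P: "lightlike_plane P" "0 \<in> P" "(1, e) \<in> P" and e: "norm e = 1"
  shows "P = {x. mform x (1, e) = 0}"
proof -
  obtain a n where n: "n \<noteq> 0" "mform n n = 0" and Pa: "P = {x. mform (x - a) n = 0}"
    using P(1) by (auto simp: lightlike_plane_def)
  have "mform a n = 0"
    using P(2) by (simp add: Pa mform_simps) (simp add: mform_def)
  then have P': "P = {x. mform x n = 0}"
    by (simp add: Pa mform_simps)
  have en: "e \<bullet> snd n = fst n"
    using P(3) by (simp add: P' mform_def)
  have ee: "e \<bullet> e = 1"
    using e by (simp add: dot_square_norm)
  have nn: "snd n \<bullet> snd n = (fst n)\<^sup>2"
    using n(2) by (simp add: mform_def power2_eq_square)
  have "(snd n - fst n *\<^sub>R e) \<bullet> (snd n - fst n *\<^sub>R e) = 0"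
    using en inner_commute[of e "snd n"]
    by (simp add: inner_diff_left inner_diff_right nn ee power2_eq_square)
  then have sn: "snd n = fst n *\<^sub>R e"
    by simp
  then have "fst n \<noteq> 0"
    using n(1) by (auto simp: prod_eq_iff)
  have "mform x n = fst n * mform x (1, e)" for x
    by (simp add: mform_def sn algebra_simps)
  then show ?thesis
    using \<open>fst n \<noteq> 0\<close> by (simp add: P')
qed

lemma dir_orthonormal:
  "y = (y \<bullet> dir a) *\<^sub>R dir a + (y \<bullet> dir (a + pi / 2)) *\<^sub>R dir (a + pi / 2)"
proof -
  have 1: "cos a * (cos a * t) + sin a * (sin a * t) = t" for t
  proof -
    have "cos a * (cos a * t) + sin a * (sin a * t) = (cos a * cos a + sin a * sin a) * t"
      by (simp only: distrib_right mult.assoc)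
    then show ?thesis
      by (simp only: sin_cos_squared_add3 mult_1)
  qed
  show ?thesis
    by (subst vec2_eq_iff)
      (simp add: inner_vec_def sum_2 sin_add cos_add algebra_simps 1)
qed

lemma closed_segment_Pair: "closed_segment (t, a) (t, b) = Pair t ` closed_segment a b"
  by (simp add: closed_segment_image_interval image_image flip: distrib_right)

text \<open>
  The reflection of the contact point in the direction of the segment lies on the circle again,
  so it is the contact point itself.
\<close>

lemma segment_tangent_contact:
  assumes tan: "segment_tangent (closed_segment (1, M - h) (1, M + h)) light_circle"
    and h: "h = w *\<^sub>R dir (a + pi / 2)" "w \<noteq> 0"
  shows "\<exists>s\<in>{-1, 1}. s *\<^sub>R dir a \<in> closed_segment (M - h) (M + h)"
proof -
  let ?E = "closed_segment (1 :: real, M - h) (1, M + h)"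
  let ?f = "dir (a + pi / 2)"
  have hull: "(1, M + u *\<^sub>R h) \<in> affine hull ?E" for u
  proof -
    have "a *\<^sub>R (1 :: real, M - h) + b *\<^sub>R (1, M + h) = (a + b, (a + b) *\<^sub>R M + (b - a) *\<^sub>R h)" for a b
      by (simp add: algebra_simps)
    moreover have "(1 - u) / 2 + (1 + u) / 2 = 1" "(1 + u) / 2 - (1 - u) / 2 = u"
      by (simp_all add: field_simps)
    ultimately have "(1, M + u *\<^sub>R h)
        = ((1 - u) / 2) *\<^sub>R (1 :: real, M - h) + ((1 + u) / 2) *\<^sub>R (1, M + h)"
      by simp
    moreover have "(1 - u) / 2 + (1 + u) / 2 = 1"
      by (simp add: field_simps)
    ultimately show ?thesis
      unfolding segment_convex_hull affine_hull_convex_hull affine_hull_2 by blast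
  qed
  obtain p where p: "p \<in> ?E" "affine hull ?E \<inter> light_circle = {p}"
    using tan by (auto simp: segment_tangent_def)
  then obtain z where z: "p = (1, z)" "z \<in> closed_segment (M - h) (M + h)"
    by (auto simp: closed_segment_Pair)
  have "p \<in> light_circle"
    using p by blast
  then have nz: "norm z = 1"
    by (simp add: light_circle_eq z)
  obtain t where t: "z = M + t *\<^sub>R h"
  proof -
    obtain u where "z = (1 - u) *\<^sub>R (M - h) + u *\<^sub>R (M + h)"
      using z(2) by (auto simp: closed_segment_def)
    then have "z = M + (2 * u - 1) *\<^sub>R h"
      by (simp add: algebra_simps scaleR_2[symmetric])
    then show ?thesis
      using that by blast
  qed
  have ff: "?f \<bullet> ?f = 1"
    by (simp add: inner_dir_dir)
  let ?z = "z - (2 * (z \<bullet> ?f)) *\<^sub>R ?f"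
  have "?z \<bullet> ?z = z \<bullet> z"
    by (simp add: inner_diff_left inner_diff_right ff inner_commute[of ?f z])
  then have "(1, ?z) \<in> light_circle"
    using nz by (simp add: light_circle_eq norm_eq_sqrt_inner)
  moreover have "?z = M + (t - 2 * (z \<bullet> ?f) / w) *\<^sub>R h"
  proof -
    have "(2 * (z \<bullet> ?f) / w) *\<^sub>R h = (2 * (z \<bullet> ?f)) *\<^sub>R ?f"
      using h by simp
    moreover have "M + (t - b) *\<^sub>R h = z - b *\<^sub>R h" for b
      by (simp add: t scaleR_diff_left)
    ultimately show ?thesis
      by simp
  qed
  then have "(1, ?z) \<in> affine hull ?E"
    by (simp only: hull)
  ultimately have "?z = z"
    using p(2) z(1) by blast
  then have "z - ?z = 0"
    by (simp only: diff_self)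
  then have "(2 * (z \<bullet> ?f)) *\<^sub>R ?f = 0"
    by simp
  moreover have "?f \<noteq> 0"
    using ff by auto
  ultimately have "z \<bullet> ?f = 0"
    by simp
  then have ze: "z = (z \<bullet> dir a) *\<^sub>R dir a"
    using dir_orthonormal[of z a] by simp
  from arg_cong[OF this, of norm] have "norm z = \<bar>z \<bullet> dir a\<bar>"
    by (simp only: norm_scaleR norm_dir mult_1_right)
  then have "z \<bullet> dir a \<in> {-1, 1}"
    using nz by auto
  then show ?thesis
    by (rule bexI[rotated]) (simp only: ze[symmetric] z(2))
qed

text \<open>The centre \<open>c\<close> is not assumed to be the origin, so tangency yields the
  contact point of edge \<open>j\<close> only as \<open>s j *\<^sub>R dir (\<theta> j)\<close> with
  a sign \<open>s j\<close>. Convexity of the polygon excludes the sign -1, and then the planes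
  through the edges are those of \<open>fan_domain\<close>.\<close>

lemma polygon_domain_eq_fan_domain:
  assumes k: "k \<ge> 3" and reg: "regular_polygon k C"
    and tan: "\<And>E. E \<in> C \<Longrightarrow> segment_tangent E light_circle"
  shows "\<exists>\<phi>. polygon_domain C = fan_domain k \<phi>"
proof -
  obtain c r \<alpha> where r: "r > 0" and C: "C = {closed_segment (regular_vertex k c r \<alpha> j)
    (regular_vertex k c r \<alpha> (Suc j)) |j. j < k}"
    using reg by (auto simp: regular_polygon_def)
  \<comment> \<open>The vertices sit half a step away from the outward edge normals
    \<open>dir (\<theta> j)\<close>; \<open>\<rho>\<close> is the inradius.\<close>
  define \<phi> where "\<phi> = \<alpha> + pi / k"
  define \<theta> where "\<theta> = (\<lambda>j :: nat. \<phi> + 2 * pi * j / k)"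
  define v where "v = (\<lambda>j :: nat. c + r *\<^sub>R dir (\<alpha> + 2 * pi * j / k))"
  define \<rho> where "\<rho> = r * cos (pi / k)"
  have e: "fan k \<phi> (int j) = dir (\<theta> j)" for j
    by (simp add: fan_def \<theta>_def)
  have C: "C = {closed_segment (1, v j) (1, v (Suc j)) |j. j < k}"
    by (simp add: C regular_vertex_def v_def dir_def)
  \<comment> \<open>Every vertex lies in the half-plane of every edge, again because the angles
    involved are odd multiples of \<open>pi / k\<close>.\<close>
  have v_le: "v j \<bullet> fan k \<phi> i \<le> c \<bullet> fan k \<phi> i + \<rho>" for j i
  proof -
    have "\<alpha> + 2 * pi * j / k - (\<phi> + 2 * pi * of_int i / k) = pi * of_int (2 * (int j - i) - 1) / k"
      using k by (simp add: \<phi>_def field_simps)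
    then have "dir (\<alpha> + 2 * pi * j / k) \<bullet> fan k \<phi> i \<le> cos (pi / k)"
      unfolding fan_def inner_dir_dir using cos_odd_multiple_le[of k "2 * (int j - i) - 1"] k by simp
    then show ?thesis
      using r by (simp add: v_def \<rho>_def inner_add_left)
  qed
  define h where "h = (\<lambda>j. (r * sin (pi / k)) *\<^sub>R dir (\<theta> j + pi / 2))"
  have v_mid: "v j = c + \<rho> *\<^sub>R dir (\<theta> j) - h j" "v (Suc j) = c + \<rho> *\<^sub>R dir (\<theta> j) + h j" for j
  proof -
    have 1: "\<alpha> + 2 * pi * j / k = \<theta> j - pi / k" "\<alpha> + 2 * pi * (Suc j) / k = \<theta> j + pi / k"
      using k by (simp_all add: \<theta>_def \<phi>_def field_simps)
    have 2: "dir (\<theta> j - b) = cos b *\<^sub>R dir (\<theta> j) - sin b *\<^sub>R dir (\<theta> j + pi / 2)"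
      "dir (\<theta> j + b) = cos b *\<^sub>R dir (\<theta> j) + sin b *\<^sub>R dir (\<theta> j + pi / 2)" for b
      by (simp_all add: vec2_eq_iff cos_diff sin_diff cos_add sin_add algebra_simps)
    show "v j = c + \<rho> *\<^sub>R dir (\<theta> j) - h j" "v (Suc j) = c + \<rho> *\<^sub>R dir (\<theta> j) + h j"
      unfolding v_def 1 \<rho>_def h_def 2[of "pi / k"] by (simp_all add: algebra_simps)
  qed
  have h_orth: "h j \<bullet> dir (\<theta> j) = 0" for j
    by (simp add: h_def inner_dir_dir)
  have seg_eq: "z \<bullet> dir (\<theta> j) = c \<bullet> dir (\<theta> j) + \<rho>" if zj: "z \<in> closed_segment (v j) (v (Suc j))" for z j
  proof -
    have "v j \<bullet> dir (\<theta> j) = c \<bullet> dir (\<theta> j) + \<rho>" "v (Suc j) \<bullet> dir (\<theta> j) = c \<bullet> dir (\<theta> j) + \<rho>"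
      unfolding v_mid(1)[of j] v_mid(2)[of j] by (simp_all add: inner_add_left inner_diff_left h_orth inner_dir_dir)
    moreover obtain u where "z = (1 - u) *\<^sub>R v j + u *\<^sub>R v (Suc j)"
      using zj by (auto simp: closed_segment_def)
    then have "z \<bullet> dir (\<theta> j) = (1 - u) * (v j \<bullet> dir (\<theta> j)) + u * (v (Suc j) \<bullet> dir (\<theta> j))"
      by (simp add: inner_add_left)
    ultimately show ?thesis
      by (simp add: algebra_simps)
  qed
  have seg_le: "z \<bullet> fan k \<phi> i \<le> c \<bullet> fan k \<phi> i + \<rho>" if zj: "z \<in> closed_segment (v j) (v (Suc j))" for z i j
  proof -
    obtain u where u: "z = (1 - u) *\<^sub>R v j + u *\<^sub>R v (Suc j)" "0 \<le> u" "u \<le> 1"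
      using zj by (auto simp: closed_segment_def)
    have "z \<bullet> fan k \<phi> i = (1 - u) * (v j \<bullet> fan k \<phi> i) + u * (v (Suc j) \<bullet> fan k \<phi> i)"
      by (simp add: u inner_add_left)
    also have "\<dots> \<le> (1 - u) * (c \<bullet> fan k \<phi> i + \<rho>) + u * (c \<bullet> fan k \<phi> i + \<rho>)"
      using u v_le by (intro add_mono mult_left_mono) auto
    finally show ?thesis
      by (simp add: algebra_simps)
  qed
  have "sin (pi / k) > 0"
    using k by (intro sin_gt_zero) (auto simp: field_simps)
  then have w: "r * sin (pi / k) \<noteq> 0"
    using r by simp
  have contact: "\<exists>s\<in>{-1, 1}. s *\<^sub>R dir (\<theta> j) \<in> closed_segment (v j) (v (Suc j))" if "j < k" for j
    unfolding v_mid(1)[of j] v_mid(2)[of j]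
  proof (rule segment_tangent_contact[OF _ _ w])
    have "closed_segment (1, v j) (1, v (Suc j)) \<in> C"
      using that by (auto simp: C)
    then show "segment_tangent (closed_segment (1, c + \<rho> *\<^sub>R dir (\<theta> j) - h j)
      (1, c + \<rho> *\<^sub>R dir (\<theta> j) + h j)) light_circle"
      using tan unfolding v_mid(1)[of j] v_mid(2)[of j] by blast
  qed (simp add: h_def)
  have "\<forall>j\<in>{..<k}. \<exists>s. s \<in> {-1, 1} \<and> s *\<^sub>R dir (\<theta> j) \<in> closed_segment (v j) (v (Suc j))"
    using contact unfolding Bex_def lessThan_iff by blast
  from bchoice[OF this] obtain s where s: "s j \<in> {-1, 1}"
    "s j *\<^sub>R dir (\<theta> j) \<in> closed_segment (v j) (v (Suc j))" if "j < k" for j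
    unfolding lessThan_iff by blast
  have s_eq: "s j = c \<bullet> dir (\<theta> j) + \<rho>" if "j < k" for j
    using seg_eq[OF s(2)[OF that]] by (simp add: inner_dir_dir)
  have s_le: "s j * (dir (\<theta> j) \<bullet> dir (\<theta> i)) \<le> s i" if "j < k" "i < k" for i j
    using seg_le[OF s(2)[OF that(1)], of "int i"] s_eq[OF that(2)] by (simp add: e)
  \<comment> \<open>If \<open>s i = -1\<close>, the half-plane of edge \<open>i\<close> would have
    to contain the contact point of the next edge, that is \<open>s j * fan_cos k \<le> -1\<close>,
    which contradicts \<open>\<bar>fan_cos k\<bar> < 1\<close>.\<close>
  have s1: "s i = 1" if "i < k" for i
  proof (rule ccontr)
    assume "s i \<noteq> 1"
    then have si: "s i = -1"
      using s(1)[OF that] by simp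
    define j where "j = nat ((int i + 1) mod int k)"
    have j: "j < k" "int j = (int i + 1) mod int k"
      using k by (auto simp: j_def nat_less_iff)
    have "dir (\<theta> j) = fan k \<phi> (int i + 1)"
      using k fan_mod[of k \<phi> "int i + 1"] by (simp add: e[symmetric] j)
    then have "dir (\<theta> j) \<bullet> dir (\<theta> i) = fan_cos k"
      by (simp add: e[symmetric])
    then have "s j * fan_cos k \<le> -1"
      using s_le[OF j(1) that] si by simp
    then show False
      using s(1)[OF j(1)] fan_cos_bounds[OF k] by auto
  qed
  let ?P = "\<lambda>j. {x. mform x (1, dir (\<theta> j)) = 0}"
  have plane: "P = ?P j \<longleftrightarrow> lightlike_plane P \<and> 0 \<in> P \<and> closed_segment (1, v j) (1, v (Suc j)) \<subseteq> P"
    if "j < k" for P j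
  proof
    assume "lightlike_plane P \<and> 0 \<in> P \<and> closed_segment (1, v j) (1, v (Suc j)) \<subseteq> P"
    moreover have "(1, dir (\<theta> j)) \<in> closed_segment (1, v j) (1, v (Suc j))"
      using s(2)[OF that] s1[OF that] by (simp add: closed_segment_Pair)
    ultimately show "P = ?P j"
      by (intro lightlike_plane_eq) auto
  next
    assume P: "P = ?P j"
    have "lightlike_plane P"
      unfolding lightlike_plane_def P
      by (intro exI[of _ 0] exI[of _ "(1, dir (\<theta> j))"]) (simp add: mform_def inner_dir_dir zero_prod_def)
    moreover have "closed_segment (1, v j) (1, v (Suc j)) \<subseteq> P"
      using seg_eq[of _ j] s_eq[OF that] s1[OF that] by (auto simp: closed_segment_Pair P mform_def)
    ultimately show "lightlike_plane P \<and> 0 \<in> P \<and> closed_segment (1, v j) (1, v (Suc j)) \<subseteq> P"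
      by (simp add: P mform_def)
  qed
  have "polygon_domain C = (\<Inter>j<k. Iplus (?P j))"
  proof -
    have "{Iplus P |P. lightlike_plane P \<and> 0 \<in> P \<and> (\<exists>E\<in>C. E \<subseteq> P)} = (\<lambda>j. Iplus (?P j)) ` {..<k}"
    proof (intro equalityI subsetI)
      fix X assume "X \<in> {Iplus P |P. lightlike_plane P \<and> 0 \<in> P \<and> (\<exists>E\<in>C. E \<subseteq> P)}"
      then obtain P j where "X = Iplus P" "j < k" "lightlike_plane P" "0 \<in> P"
        "closed_segment (1, v j) (1, v (Suc j)) \<subseteq> P"
        unfolding C by blast
      with plane[of j P] have "X = Iplus (?P j)" "j < k"
        by auto
      then show "X \<in> (\<lambda>j. Iplus (?P j)) ` {..<k}"
        by auto
    next
      fix X assume "X \<in> (\<lambda>j. Iplus (?P j)) ` {..<k}"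
      then obtain j where "X = Iplus (?P j)" "j < k"
        by auto
      then show "X \<in> {Iplus P |P. lightlike_plane P \<and> 0 \<in> P \<and> (\<exists>E\<in>C. E \<subseteq> P)}"
        using plane[of j "?P j"] C by blast
    qed
    then show ?thesis
      by (simp add: polygon_domain_def)
  qed
  also have "\<dots> = fan_domain k \<phi>"
  proof -
    have "{0..<int k} = int ` {..<k}"
      using image_int_atLeastLessThan[of 0 k] by (simp add: lessThan_atLeast0)
    then show ?thesis
      using k by (simp add: Iplus_lightlike_plane fan_domain_Int e)
  qed
  finally show ?thesis
    by blast
qed

section \<open>Weak convergence\<close>

text \<open>Split off the smaller coordinate: the point is \<open>x - x'\<close> times one direction
  plus \<open>x'\<close> times \<open>e_n + e_(n+1)\<close>, and each part has its own
  bound.\<close>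

lemma fan_sector_max:
  assumes k: "k \<ge> 3" and x: "0 \<le> x'" "x' \<le> x"
  shows "(x *\<^sub>R fan k \<phi> n + x' *\<^sub>R fan k \<phi> (n + 1)) \<bullet> fan k \<phi> i \<le> x + fan_cos k * x'"
    and "(x' *\<^sub>R fan k \<phi> n + x *\<^sub>R fan k \<phi> (n + 1)) \<bullet> fan k \<phi> i \<le> x + fan_cos k * x'"
proof -
  let ?a = "fan k \<phi> n \<bullet> fan k \<phi> i" and ?b = "fan k \<phi> (n + 1) \<bullet> fan k \<phi> i"
  have ab: "?a \<le> 1" "?b \<le> 1"
    using norm_cauchy_schwarz[of "fan k \<phi> n" "fan k \<phi> i"]
      norm_cauchy_schwarz[of "fan k \<phi> (n + 1)" "fan k \<phi> i"] by simp_all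
  have "x' * (?a + ?b) \<le> x' * (1 + fan_cos k)"
    using fan_mid_inner_le[OF k, of \<phi> n i] x by (intro mult_left_mono) (auto simp: inner_add_left)
  moreover have "(x - x') * ?a \<le> (x - x') * 1" "(x - x') * ?b \<le> (x - x') * 1"
    using ab x by (intro mult_left_mono; simp)+
  ultimately have "(x - x') * ?a + x' * (?a + ?b) \<le> x + fan_cos k * x'"
    "(x - x') * ?b + x' * (?a + ?b) \<le> x + fan_cos k * x'"
    by (simp_all add: algebra_simps)
  then show "(x *\<^sub>R fan k \<phi> n + x' *\<^sub>R fan k \<phi> (n + 1)) \<bullet> fan k \<phi> i \<le> x + fan_cos k * x'"
    and "(x' *\<^sub>R fan k \<phi> n + x *\<^sub>R fan k \<phi> (n + 1)) \<bullet> fan k \<phi> i \<le> x + fan_cos k * x'"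
    by (simp_all add: inner_add_left algebra_simps)
qed

lemma Max_fan_image:
  assumes "k > 0" and le: "\<And>i. f (fan k \<phi> i) (fan k \<phi> (i + 1)) \<le> b"
    and eq: "f (fan k \<phi> n) (fan k \<phi> (n + 1)) = b"
  shows "Max ((\<lambda>i. f (fan k \<phi> i) (fan k \<phi> (i + 1))) ` {0..<int k}) = b"
proof (rule Max_eqI)
  have "\<not> (\<forall>n. f (fan k \<phi> n) (fan k \<phi> (n + 1)) \<noteq> b)"
    using eq by blast
  then show "b \<in> (\<lambda>i. f (fan k \<phi> i) (fan k \<phi> (i + 1))) ` {0..<int k}"
    using all_fan_iff[OF assms(1), of "\<lambda>x y. f x y \<noteq> b"] by auto
qed (use le in auto)

text \<open>This expresses \<open>\<bar>x - x'\<bar>\<close> without choosing a sector. Finite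
  maxima of linear functions make the measurability visible.\<close>

lemma frequency_fan_domain_eq_Max:
  assumes k: "k \<ge> 3"
  shows "frequency (fan_domain k \<phi>) y =
    (2 * Max ((\<lambda>i. y \<bullet> fan k \<phi> i) ` {0..<int k})
      - Max ((\<lambda>i. y \<bullet> (fan k \<phi> i + fan k \<phi> (i + 1))) ` {0..<int k})) / (1 - fan_cos k)"
proof -
  let ?c = "fan_cos k"
  have c: "?c < 1"
    using fan_cos_bounds[OF k] by simp
  have k0: "k > 0"
    using k by simp
  obtain n x x' where x: "0 \<le> x" "0 \<le> x'" and y: "y = x *\<^sub>R fan k \<phi> n + x' *\<^sub>R fan k \<phi> (n + 1)"
    using fan_sector[OF k] by blast
  have "Max ((\<lambda>i. y \<bullet> (fan k \<phi> i + fan k \<phi> (i + 1))) ` {0..<int k}) = (x + x') * (1 + ?c)"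
  proof (rule Max_fan_image[OF k0, of "\<lambda>a b. y \<bullet> (a + b)"])
    show "y \<bullet> (fan k \<phi> i + fan k \<phi> (i + 1)) \<le> (x + x') * (1 + ?c)" for i
      unfolding y by (rule fan_sector_mid_le[OF k x])
    show "y \<bullet> (fan k \<phi> n + fan k \<phi> (n + 1)) = (x + x') * (1 + ?c)"
      unfolding y by (simp add: inner_add_left inner_add_right) (simp add: algebra_simps)
  qed
  moreover have "Max ((\<lambda>i. y \<bullet> fan k \<phi> i) ` {0..<int k}) = max x x' + ?c * min x x'"
  proof (cases "x' \<le> x")
    case True
    have "Max ((\<lambda>i. y \<bullet> fan k \<phi> i) ` {0..<int k}) = x + ?c * x'"
    proof (rule Max_fan_image[OF k0, of "\<lambda>a b. y \<bullet> a" _ _ n])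
      show "y \<bullet> fan k \<phi> i \<le> x + ?c * x'" for i
        unfolding y by (rule fan_sector_max[OF k x(2) True])
      show "y \<bullet> fan k \<phi> n = x + ?c * x'"
        unfolding y by (simp add: inner_add_left)
    qed
    with True show ?thesis
      by (simp add: max_def min_def)
  next
    case False
    have "Max ((\<lambda>i. y \<bullet> fan k \<phi> i) ` {0..<int k}) = x' + ?c * x"
    proof (rule Max_fan_image[OF k0, of "\<lambda>a b. y \<bullet> a" _ _ "n + 1"])
      show "y \<bullet> fan k \<phi> i \<le> x' + ?c * x" for i
        unfolding y using False by (intro fan_sector_max(2)[OF k x(1)]) simp
      show "y \<bullet> fan k \<phi> (n + 1) = x' + ?c * x"
        unfolding y by (simp add: inner_add_left)
    qed
    with False show ?thesis
      by (simp add: max_def min_def)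
  qed
  moreover have "2 * (max x x' + ?c * min x x') - (x + x') * (1 + ?c) = \<bar>x - x'\<bar> * (1 - ?c)"
    by (auto simp: max_def min_def abs_if algebra_simps)
  ultimately show ?thesis
    using c unfolding y frequency_fan_domain[OF k x] by simp
qed

lemma borel_measurable_frequency_fan_domain [measurable]:
  assumes "k \<ge> 3"
  shows "frequency (fan_domain k \<phi>) \<in> borel_measurable borel"
proof -
  have "(\<lambda>y. (2 * Max ((\<lambda>i. y \<bullet> fan k \<phi> i) ` {0..<int k})
      - Max ((\<lambda>i. y \<bullet> (fan k \<phi> i + fan k \<phi> (i + 1))) ` {0..<int k})) / (1 - fan_cos k))
    \<in> borel_measurable borel"
    by measurable
  then show ?thesis
    using frequency_fan_domain_eq_Max[OF assms, of \<phi>] by (simp cong: measurable_cong)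
qed

lemma frequency_fan_domain_bounds:
  assumes k: "k \<ge> 3"
  shows "0 \<le> frequency (fan_domain k \<phi>) y" "frequency (fan_domain k \<phi>) y \<le> norm y"
proof -
  obtain n x x' where x: "0 \<le> x" "0 \<le> x'" and y: "y = x *\<^sub>R fan k \<phi> n + x' *\<^sub>R fan k \<phi> (n + 1)"
    using fan_sector[OF k] by blast
  have f: "frequency (fan_domain k \<phi>) y = \<bar>x - x'\<bar>"
    unfolding y by (rule frequency_fan_domain[OF k x])
  have "(norm y)\<^sup>2 = (x - x')\<^sup>2 + 2 * (1 + fan_cos k) * (x * x')"
    unfolding power2_norm_eq_inner y
    by (simp add: inner_add_left inner_add_right) (simp add: power2_eq_square algebra_simps)
  also have "\<dots> \<ge> (x - x')\<^sup>2"
    using x fan_cos_bounds[OF k] by simp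
  finally have "\<bar>x - x'\<bar>\<^sup>2 \<le> (norm y)\<^sup>2"
    by simp
  then show "frequency (fan_domain k \<phi>) y \<le> norm y" "0 \<le> frequency (fan_domain k \<phi>) y"
    unfolding f by (auto intro: power2_le_imp_le)
qed

section \<open>Rotations and their invariance of area\<close>

definition rot :: "real \<Rightarrow> real^2 \<Rightarrow> real^2" where
  "rot d y = vector [cos d * y $ 1 - sin d * y $ 2, sin d * y $ 1 + cos d * y $ 2]"

lemma rot_nth [simp]: "rot d y $ 1 = cos d * y $ 1 - sin d * y $ 2"
    "rot d y $ 2 = sin d * y $ 1 + cos d * y $ 2"
  by (simp_all add: rot_def)

lemma rot_dir [simp]: "rot d (dir a) = dir (a + d)"
  by (simp add: vec2_eq_iff sin_add cos_add)

lemma linear_rot: "linear (rot d)"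
  by (intro linearI) (simp_all add: vec2_eq_iff algebra_simps)

lemma norm_rot [simp]: "norm (rot d y) = norm y"
proof -
  obtain \<psi> where \<psi>: "y = norm y *\<^sub>R dir \<psi>"
    using polar_form by blast
  have "rot d (norm y *\<^sub>R dir \<psi>) = norm y *\<^sub>R dir (\<psi> + d)"
    by (simp add: linear_scale[OF linear_rot])
  then have "rot d y = norm y *\<^sub>R dir (\<psi> + d)"
    unfolding \<psi>[symmetric] .
  then show ?thesis
    by simp
qed

lemma orthogonal_transformation_rot: "orthogonal_transformation (rot d)"
  by (simp add: orthogonal_transformation linear_rot)

lemma rot_minus_rot [simp]: "rot (- d) (rot d y) = y" "rot d (rot (- d) y) = y"
proof -
  have "rot (- d) (rot d y) = y" for d y
  proof -
    obtain \<psi> where \<psi>: "y = norm y *\<^sub>R dir \<psi>"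
      using polar_form by blast
    have "rot (- d) (rot d (norm y *\<^sub>R dir \<psi>)) = norm y *\<^sub>R dir \<psi>"
      by (simp add: linear_scale[OF linear_rot])
    then show ?thesis
      unfolding \<psi>[symmetric] .
  qed
  from this[of d y] this[of "- d" y]
  show "rot (- d) (rot d y) = y" "rot d (rot (- d) y) = y"
    by simp_all
qed

lemma borel_measurable_rot [measurable]: "rot d \<in> borel_measurable borel"
  by (intro borel_measurable_continuous_onI linear_continuous_on linear_conv_bounded_linear[THEN iffD1]
      linear_rot)

text \<open>Values on boxes determine \<open>lborel\<close>. The preimage of a box is its image
  under the inverse rotation, and orthogonal maps preserve Lebesgue measure.\<close>

lemma distr_lborel_rot: "distr lborel borel (rot d) = lborel"
proof (rule lborel_eqI[symmetric])
  fix l u :: "real^2" assume lu: "\<And>b. b \<in> Basis \<Longrightarrow> l \<bullet> b \<le> u \<bullet> b"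
  have op: "open (rot (- d) ` box l u)"
    using orthogonal_transformation_rot[of "- d"] linear_rot
    by (intro open_surjective_linear_image)
      (auto simp: orthogonal_transformation_surj)
  have bd: "bounded (rot (- d) ` box l u)"
    by (intro bounded_linear_image linear_conv_bounded_linear[THEN iffD1] linear_rot) simp
  have vim: "rot d -` box l u = rot (- d) ` box l u"
    by (auto intro!: image_eqI[of _ _ "rot d _"])
  have "emeasure (distr lborel borel (rot d)) (box l u) = emeasure lborel (rot (- d) ` box l u)"
    by (simp add: emeasure_distr vim)
  also have "\<dots> = emeasure lebesgue (rot (- d) ` box l u)"
    using op by simp
  also have "\<dots> = measure lebesgue (rot (- d) ` box l u)"
    by (intro emeasure_eq_measure2 lmeasurable_open op bd)
  also have "measure lebesgue (rot (- d) ` box l u) = measure lebesgue (box l u)"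
    by (intro measure_orthogonal_image orthogonal_transformation_rot) simp
  also have "ennreal (measure lebesgue (box l u)) = emeasure lebesgue (box l u)"
    by (intro emeasure_eq_measure2[symmetric]) simp
  also have "\<dots> = emeasure lborel (box l u)"
    by simp
  also have "\<dots> = (\<Prod>b\<in>Basis. (u - l) \<bullet> b)"
    by (rule emeasure_lborel_box[OF lu])
  finally show "emeasure (distr lborel borel (rot d)) (box l u) = (\<Prod>b\<in>Basis. (u - l) \<bullet> b)" .
qed simp

lemma integral_lborel_rot:
  fixes f :: "real^2 \<Rightarrow> real"
  assumes "f \<in> borel_measurable borel"
  shows "(LINT y|lborel. f (rot d y)) = (LINT y|lborel. f y)"
  using integral_distr[of "rot d" lborel borel f] assms by (simp add: distr_lborel_rot)

lemma rot_rot_fan: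
  assumes "k > 0"
  shows "rot (pi / k) (rot (pi / k) (fan k \<phi> n)) = fan k \<phi> (n + 1)"
proof -
  have "\<phi> + 2 * pi * of_int n / k + pi / k + pi / k = \<phi> + 2 * pi * of_int (n + 1) / k"
    using assms by (simp add: field_simps)
  then show ?thesis
    by (simp only: fan_def rot_dir)
qed

lemma fan_add_fan_Suc:
  assumes "k > 0"
  shows "fan k \<phi> n + fan k \<phi> (n + 1) = (2 * cos (pi / k)) *\<^sub>R rot (pi / k) (fan k \<phi> n)"
proof -
  have 1: "(\<phi> + 2 * pi * of_int (n + 1) / k - (\<phi> + 2 * pi * of_int n / k)) / 2 = pi / k"
    and 2: "(\<phi> + 2 * pi * of_int n / k + (\<phi> + 2 * pi * of_int (n + 1) / k)) / 2
      = \<phi> + 2 * pi * of_int n / k + pi / k"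
    using assms by (simp_all add: field_simps)
  show ?thesis
    unfolding fan_def dir_add_dir 1 2 rot_dir ..
qed

section \<open>Frequency function after rotation by half a step\<close>

text \<open>Half a step turns rays into bisectors and bisectors into rays. After splitting off the
  smaller coordinate, the part of size \<open>\<bar>x - x'\<bar>\<close> lands on a bisector, where
  both coordinates agree and cancel, and the part along \<open>e_n + e_(n+1)\<close> lands on the
  ray of \<open>e_(n+1)\<close>.\<close>

lemma frequency_rot:
  fixes n :: int
  assumes k: "k \<ge> 3" and x: "0 \<le> x" "0 \<le> x'"
  shows "frequency (fan_domain k \<phi>) (rot (pi / k) (x *\<^sub>R fan k \<phi> n + x' *\<^sub>R fan k \<phi> (n + 1)))
    = 2 * cos (pi / k) * min x x'"
proof -
  let ?R = "rot (pi / k)" and ?e = "fan k \<phi>" and ?c = "cos (pi / k)"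
  have c: "?c > 0"
    using cos_pi_div_pos[OF k] by simp
  have k0: "k > 0"
    using k by simp
  have R: "?R (?e m) = (1 / (2 * ?c)) *\<^sub>R (?e m + ?e (m + 1))" for m
    unfolding fan_add_fan_Suc[OF k0] using c by simp
  have Rmid: "?R (?e m + ?e (m + 1)) = (2 * ?c) *\<^sub>R ?e (m + 1)" for m
    unfolding fan_add_fan_Suc[OF k0] linear_scale[OF linear_rot] rot_rot_fan[OF k0] ..
  show ?thesis
  proof (cases "x' \<le> x")
    case True
    define a b where ab_def: "a = (x - x') / (2 * ?c)" "b = 2 * ?c * x'"
    have ab: "0 \<le> a" "0 \<le> b"
      using True x c by (simp_all add: ab_def)
    have "x *\<^sub>R ?e n + x' *\<^sub>R ?e (n + 1) = (x - x') *\<^sub>R ?e n + x' *\<^sub>R (?e n + ?e (n + 1))"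
      by (simp add: scaleR_diff_left scaleR_add_right)
    then have "?R (x *\<^sub>R ?e n + x' *\<^sub>R ?e (n + 1)) = (x - x') *\<^sub>R ?R (?e n) + x' *\<^sub>R ?R (?e n + ?e (n + 1))"
      by (simp only: linear_add[OF linear_rot] linear_scale[OF linear_rot])
    also have "\<dots> = a *\<^sub>R ?e n + (a + b) *\<^sub>R ?e (n + 1)"
      unfolding R Rmid by (simp add: ab_def scaleR_add_left scaleR_add_right mult.commute)
    finally show ?thesis
      using frequency_fan_domain[OF k, of a "a + b" \<phi> n] ab True by (simp add: ab_def)
  next
    case False
    \<comment> \<open>Now the larger coordinate belongs to \<open>e_(n+1)\<close>, so the rotated
      point lies in the next sector.\<close>
    define a b where ab_def: "a = (x' - x) / (2 * ?c)" "b = 2 * ?c * x"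
    have ab: "0 \<le> a" "0 \<le> b"
      using False x c by (simp_all add: ab_def)
    have "x *\<^sub>R ?e n + x' *\<^sub>R ?e (n + 1) = (x' - x) *\<^sub>R ?e (n + 1) + x *\<^sub>R (?e n + ?e (n + 1))"
      by (simp add: scaleR_diff_left scaleR_add_right)
    then have "?R (x *\<^sub>R ?e n + x' *\<^sub>R ?e (n + 1))
        = (x' - x) *\<^sub>R ?R (?e (n + 1)) + x *\<^sub>R ?R (?e n + ?e (n + 1))"
      by (simp only: linear_add[OF linear_rot] linear_scale[OF linear_rot])
    also have "\<dots> = (a + b) *\<^sub>R ?e (n + 1) + a *\<^sub>R ?e (n + 1 + 1)"
      unfolding R Rmid by (simp add: ab_def scaleR_add_left scaleR_add_right mult.commute)
    finally show ?thesis
      using frequency_fan_domain[OF k, of "a + b" a \<phi> "n + 1"] ab False by (simp add: ab_def)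
  qed
qed

text \<open>With \<open>a\<close>, \<open>b\<close> the two frequencies, \<open>y\<close> is
  \<open>a\<close> times a contact direction plus \<open>b\<close> times the unit bisector at angle
  \<open>pi / k\<close>. The law of cosines gives
  \<open>\<bar>y\<bar>^2 = a^2 + b^2 + 2 a b cos (pi / k)\<close>, which is compared with
  \<open>(a + b)^2\<close>.\<close>

lemma frequency_add_frequency_rot:
  fixes y :: "real^2" and \<phi> :: real
  assumes k: "k \<ge> 3"
  defines "s \<equiv> frequency (fan_domain k \<phi>) y + frequency (fan_domain k \<phi>) (rot (pi / k) y)"
  shows "norm y \<le> s" "s \<le> norm y / sqrt (cos (pi / k))"
proof -
  let ?c = "cos (pi / k)"
  have c: "0 < ?c" "?c < 1"
    using cos_pi_div_pos[OF k] by simp_all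
  obtain n x x' where x: "0 \<le> x" "0 \<le> x'" and y: "y = x *\<^sub>R fan k \<phi> n + x' *\<^sub>R fan k \<phi> (n + 1)"
    using fan_sector[OF k] by blast
  define a b where ab_def: "a = \<bar>x - x'\<bar>" "b = 2 * ?c * min x x'"
  have ab: "0 \<le> a" "0 \<le> b"
    using x c by (simp_all add: ab_def)
  have s: "s = a + b"
    unfolding s_def y frequency_fan_domain[OF k x] frequency_rot[OF k x] ab_def ..
  have fc: "fan_cos k = 2 * ?c\<^sup>2 - 1"
    using k by (intro fan_cos_eq) simp
  have "(norm y)\<^sup>2 = x\<^sup>2 + x'\<^sup>2 + 2 * fan_cos k * (x * x')"
    unfolding power2_norm_eq_inner y
    by (simp add: inner_add_left inner_add_right) (simp add: power2_eq_square algebra_simps)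
  also have "\<dots> = a\<^sup>2 + b\<^sup>2 + 2 * (a * b) * ?c"
    unfolding fc ab_def by (cases "x \<le> x'") (simp_all add: power2_eq_square algebra_simps)
  finally have ny: "(norm y)\<^sup>2 = a\<^sup>2 + b\<^sup>2 + 2 * (a * b) * ?c" .
  have "2 * (a * b) * ?c \<le> 2 * (a * b) * 1"
    using ab c by (intro mult_left_mono) auto
  then have "(norm y)\<^sup>2 \<le> s\<^sup>2"
    unfolding ny s by (simp add: power2_sum)
  then show "norm y \<le> s"
    by (rule power2_le_imp_le) (use ab s in simp)
  have "?c * (a\<^sup>2 + b\<^sup>2) \<le> 1 * (a\<^sup>2 + b\<^sup>2)"
    using c by (intro mult_right_mono) auto
  then have "?c * s\<^sup>2 \<le> (norm y)\<^sup>2"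
    unfolding ny s by (simp add: power2_sum algebra_simps)
  then have "(sqrt ?c * s)\<^sup>2 \<le> (norm y)\<^sup>2"
    using c by (simp add: power_mult_distrib)
  then have "sqrt ?c * s \<le> norm y"
    by (rule power2_le_imp_le) simp
  then show "s \<le> norm y / sqrt ?c"
    using c by (simp add: field_simps)
qed

section \<open>Local integrability and passage to the limit\<close>

lemma locally_integrable_bounded:
  assumes [measurable]: "f \<in> borel_measurable borel" and "\<And>y. \<bar>f y\<bar> \<le> norm y"
  shows "locally_integrable f"
  unfolding locally_integrable_def
proof (intro allI impI)
  fix K :: "(real^2) set" assume K: "compact K"
  obtain B where B: "\<And>y. y \<in> K \<Longrightarrow> norm y \<le> B"
    using compact_imp_bounded[OF K] bounded_iff by blast
  have [measurable]: "K \<in> sets borel"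
    using K by (simp add: borel_compact)
  have "integrable lborel (\<lambda>y. B * indicator K y :: real)"
    using emeasure_compact_finite[OF K] K
    by (intro integrable_mult_right) (simp add: integrable_indicator_iff borel_compact)
  then show "set_integrable lborel K f"
    unfolding set_integrable_def
    by (rule Bochner_Integration.integrable_bound)
      (use assms(2) B order_trans in \<open>fastforce simp: indicator_def\<close>)+
qed

text \<open>The angles \<open>\<psi> k\<close> are arbitrary, so the polygons need not be aligned.
  The shift by 3 makes every index admissible.\<close>

lemma weak_limit_fan:
  fixes f :: "real^2 \<Rightarrow> real" and \<psi> :: "nat \<Rightarrow> real"
  assumes cont: "continuous_on UNIV f" and supp: "compact (closure {y. f y \<noteq> 0})"
  shows "(\<lambda>k. LINT y|lborel. f y * frequency (fan_domain (k + 3) (\<psi> k)) y)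
    \<longlonglongrightarrow> 1 / 2 * (LINT y|lborel. f y * norm y)"
proof -
  define F where "F = (\<lambda>k. frequency (fan_domain (k + 3) (\<psi> k)))"
  define R where "R = (\<lambda>k :: nat. rot (pi / real (k + 3)))"
  have F_meas [measurable]: "F k \<in> borel_measurable borel" for k
    unfolding F_def by (rule borel_measurable_frequency_fan_domain) simp
  have R_meas [measurable]: "R k \<in> borel_measurable borel" for k
    unfolding R_def by (rule borel_measurable_rot)
  have f_meas [measurable]: "f \<in> borel_measurable borel"
    using cont by (rule borel_measurable_continuous_onI)
  have F_bound: "0 \<le> F k y" "F k y \<le> norm y" for k y
    unfolding F_def by (rule frequency_fan_domain_bounds; simp)+
  have normR: "norm (R k y) = norm y" for k y
    by (simp add: R_def)
  have "bounded (closure {y. f y \<noteq> 0})"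
    using supp by (rule compact_imp_bounded)
  then obtain \<rho> where "\<And>y. y \<in> closure {y. f y \<noteq> 0} \<Longrightarrow> norm y \<le> \<rho>"
    unfolding bounded_iff by blast
  then have \<rho>: "norm y \<le> \<rho>" if "f y \<noteq> 0" for y
    using that closure_subset[of "{y. f y \<noteq> 0}"] by blast
  have "bounded (f ` cball 0 \<rho>)"
    by (intro compact_imp_bounded compact_continuous_image continuous_on_subset[OF cont]) auto
  then obtain B where "\<And>y. y \<in> cball 0 \<rho> \<Longrightarrow> norm (f y) \<le> B"
    unfolding bounded_iff by blast
  then have B: "\<bar>f y\<bar> \<le> B" if "norm y \<le> \<rho>" for y
    using that by auto
  \<comment> \<open>The majorant depends only on \<open>norm y\<close>, so it serves for
    \<open>y\<close> and for its rotated copy alike.\<close>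
  define w where "w = (\<lambda>y :: real^2. (B * \<rho>) * indicator (cball 0 \<rho>) y :: real)"
  have w_int: "integrable lborel w"
    unfolding w_def
    using emeasure_compact_finite[OF compact_cball[of "0 :: real^2" \<rho>]]
    by (intro integrable_mult_right) (simp add: integrable_indicator_iff)
  have bound: "\<bar>f z * F k z'\<bar> \<le> w y" if "norm z = norm y" "norm z' = norm y" for k y z z'
  proof (cases "f z = 0")
    case True
    have "0 \<le> B * \<rho>" if "norm y \<le> \<rho>"
      using B[OF that] that norm_ge_zero[of y] by (intro mult_nonneg_nonneg) linarith+
    with True show ?thesis
      by (auto simp: w_def indicator_def)
  next
    case False
    then have y: "norm y \<le> \<rho>"
      using \<rho>[of z] that by simp
    have "\<bar>f z\<bar> * \<bar>F k z'\<bar> \<le> B * \<rho>"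
      using B[of z] y that F_bound[of k z'] by (intro mult_mono) auto
    then show ?thesis
      using y by (simp add: w_def abs_mult)
  qed
  have int1: "integrable lborel (\<lambda>y. f y * F k y)" for k
    by (rule Bochner_Integration.integrable_bound[OF w_int])
      (use bound in \<open>auto intro!: order.trans[OF _ abs_ge_self]\<close>)
  have int2: "integrable lborel (\<lambda>y. f (R k y) * F k (R k y))" for k
    by (rule Bochner_Integration.integrable_bound[OF w_int])
      (use bound normR in \<open>auto intro!: order.trans[OF _ abs_ge_self]\<close>)
  define G where "G = (\<lambda>k y. f y * F k y + f (R k y) * F k (R k y))"
  have G_int: "(LINT y|lborel. G k y) = 2 * (LINT y|lborel. f y * F k y)" for k
  proof -
    have "(LINT y|lborel. f (R k y) * F k (R k y)) = (LINT y|lborel. f y * F k y)"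
      unfolding R_def by (rule integral_lborel_rot) measurable
    then show ?thesis
      unfolding G_def by (simp add: int1 int2)
  qed
  have angle: "(\<lambda>k. pi / real (k + 3)) \<longlonglongrightarrow> 0"
    using LIMSEQ_ignore_initial_segment[OF lim_const_over_n[of pi], of 3] by simp
  have lim: "(\<lambda>k. G k y) \<longlonglongrightarrow> f y * norm y" for y
  proof -
    have cos1: "(\<lambda>k. cos (pi / real (k + 3))) \<longlonglongrightarrow> 1"
      using tendsto_cos[OF angle] by simp
    have "(\<lambda>k. norm y / sqrt (cos (pi / real (k + 3)))) \<longlonglongrightarrow> norm y / sqrt 1"
      by (intro tendsto_intros cos1) simp
    then have upper: "(\<lambda>k. norm y / sqrt (cos (pi / real (k + 3)))) \<longlonglongrightarrow> norm y"
      by simp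
    have "norm y \<le> F k y + F k (R k y)"
      "F k y + F k (R k y) \<le> norm y / sqrt (cos (pi / real (k + 3)))" for k
      unfolding F_def R_def by (rule frequency_add_frequency_rot, simp)+
    then have "(\<lambda>k. F k y + F k (R k y)) \<longlonglongrightarrow> norm y"
      by (intro real_tendsto_sandwich[OF _ _ tendsto_const upper] always_eventually allI)
    then have 1: "(\<lambda>k. f y * (F k y + F k (R k y))) \<longlonglongrightarrow> f y * norm y"
      by (intro tendsto_intros)
    \<comment> \<open>Only the sum of the two frequencies is known to converge. The test function at
      the rotated point is therefore replaced by its value at \<open>y\<close>; the error is
      multiplied by a bounded factor and vanishes by continuity.\<close>
    have "(\<lambda>k. R k y) \<longlonglongrightarrow> y"
    proof (rule vec_tendstoI)
      fix i :: 2
      have s: "(\<lambda>k. sin (pi / real (k + 3))) \<longlonglongrightarrow> 0"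
        using tendsto_sin[OF angle] by simp
      have "(\<lambda>k. R k y $ 1) \<longlonglongrightarrow> 1 * y $ 1 - 0 * y $ 2" "(\<lambda>k. R k y $ 2) \<longlonglongrightarrow> 0 * y $ 1 + 1 * y $ 2"
        unfolding R_def rot_nth by (intro tendsto_intros cos1 s)+
      then show "(\<lambda>k. R k y $ i) \<longlonglongrightarrow> y $ i"
        using exhaust_2[of i] by auto
    qed
    then have "(\<lambda>k. f (R k y)) \<longlonglongrightarrow> f y"
      using cont by (auto intro: continuous_on_tendsto_compose)
    then have "(\<lambda>k. \<bar>f (R k y) - f y\<bar> * norm y) \<longlonglongrightarrow> 0"
      by (intro tendsto_mult_left_zero tendsto_rabs_zero LIM_zero)
    then have "(\<lambda>k. (f (R k y) - f y) * F k (R k y)) \<longlonglongrightarrow> 0"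
    proof (rule Lim_null_comparison[rotated], intro always_eventually allI)
      fix k
      have "F k (R k y) \<le> norm y"
        using F_bound(2)[of k "R k y"] normR by simp
      then show "norm ((f (R k y) - f y) * F k (R k y)) \<le> \<bar>f (R k y) - f y\<bar> * norm y"
        using F_bound(1) by (simp add: abs_mult mult_left_mono)
    qed
    from tendsto_add[OF 1 this] show ?thesis
      by (simp add: G_def algebra_simps)
  qed
  have "(\<lambda>k. LINT y|lborel. G k y) \<longlonglongrightarrow> (LINT y|lborel. f y * norm y)"
  proof (rule integral_dominated_convergence)
    show "integrable lborel (\<lambda>y. 2 * w y)"
      using w_int by simp
    show "AE y in lborel. norm (G k y) \<le> 2 * w y" for k
    proof (rule AE_I2)
      fix y
      have "\<bar>f y * F k y\<bar> \<le> w y" "\<bar>f (R k y) * F k (R k y)\<bar> \<le> w y"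
        by (intro bound refl normR)+
      then show "norm (G k y) \<le> 2 * w y"
        unfolding G_def real_norm_def by linarith
    qed
    show "(\<lambda>y. f y * norm y) \<in> borel_measurable lborel"
      by measurable
    show "G k \<in> borel_measurable lborel" for k
      unfolding G_def by measurable
  qed (use lim in auto)
  then have "(\<lambda>k. 1 / 2 * (LINT y|lborel. G k y)) \<longlonglongrightarrow> 1 / 2 * (LINT y|lborel. f y * norm y)"
    by (intro tendsto_intros)
  then show ?thesis
    by (simp add: G_int F_def)
qed

theorem proposition4p1:
  fixes C :: "nat \<Rightarrow> mink set set"
  assumes "\<And>k. k \<ge> 3 \<Longrightarrow> regular_polygon k (C k)"
    and "\<And>k E. k \<ge> 3 \<Longrightarrow> E \<in> C k \<Longrightarrow> segment_tangent E light_circle"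
  shows "locally_integrable (frequency (Iplus {0})) \<and>
    (\<forall>k\<ge>3. locally_integrable (frequency (polygon_domain (C k)))) \<and>
    (\<forall>\<phi> :: real^2 \<Rightarrow> real. continuous_on UNIV \<phi> \<and> compact (closure {y. \<phi> y \<noteq> 0}) \<longrightarrow>
      (\<lambda>k. LINT y|lborel. \<phi> y * frequency (polygon_domain (C k)) y)
        \<longlonglongrightarrow> 1 / 2 * (LINT y|lborel. \<phi> y * frequency (Iplus {0}) y))"
proof -
  have "\<forall>k. \<exists>\<phi>. k \<ge> 3 \<longrightarrow> polygon_domain (C k) = fan_domain k \<phi>"
    using polygon_domain_eq_fan_domain assms by blast
  then obtain \<psi> where \<psi>: "\<And>k. k \<ge> 3 \<Longrightarrow> polygon_domain (C k) = fan_domain k (\<psi> k)"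
    by metis
  have cone: "frequency (Iplus {0}) = norm"
    by (simp add: fun_eq_iff frequency_Iplus_0)
  show ?thesis
  proof (intro conjI allI impI)
    show "locally_integrable (frequency (Iplus {0}))"
      unfolding cone by (intro locally_integrable_bounded) auto
  next
    fix k :: nat assume k: "3 \<le> k"
    show "locally_integrable (frequency (polygon_domain (C k)))"
      unfolding \<psi>[OF k]
      using frequency_fan_domain_bounds[OF k] borel_measurable_frequency_fan_domain[OF k]
      by (intro locally_integrable_bounded) (simp_all add: abs_of_nonneg)
  next
    fix f :: "real^2 \<Rightarrow> real"
    assume f: "continuous_on UNIV f \<and> compact (closure {y. f y \<noteq> 0})"
    show "(\<lambda>k. LINT y|lborel. f y * frequency (polygon_domain (C k)) y)
      \<longlonglongrightarrow> 1 / 2 * (LINT y|lborel. f y * frequency (Iplus {0}) y)"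
    \<comment> \<open>The hypotheses say nothing about \<open>C k\<close> for \<open>k < 3\<close>,
      and the limit ignores these terms.\<close>
    proof (rule LIMSEQ_offset[where k = 3])
      have "polygon_domain (C (k + 3)) = fan_domain (k + 3) (\<psi> (k + 3))" for k
        by (rule \<psi>) simp
      then show "(\<lambda>k. LINT y|lborel. f y * frequency (polygon_domain (C (k + 3))) y)
        \<longlonglongrightarrow> 1 / 2 * (LINT y|lborel. f y * frequency (Iplus {0}) y)"
        using weak_limit_fan[of f "\<lambda>k. \<psi> (k + 3)"] f unfolding cone by simp
    qed
  qed
qed

end
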